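(* Let $G$ be a (possibly infinite) simple graph and let $r\ge 3$ be an integer. Then the $r$-local cover $G_r$ of $G$ is chordal if and only if $G_r$ is $r$-chordal and wheel-free.
   Context: A graph is chordal if every cycle of length at least $4$ has a chord, and $r$-chordal if every cycle of length at least $4$ and at most $r$ has a chord. A wheel $W_n$ ($n\ge4$) is a cycle of length $n$ together with a vertex adjacent to all its vertices; wheel-free means no induced $W_n$ with $n\ge4$. $B_G(v,r/2)$ is the subgraph consisting of vertices at distance at most $r/2$ from $v$ and edges whose endpoints' distances to $v$ sum to strictly less than $r$. A covering of $G$ is a surjective homomorphism $p\colon\hat G\to G$ restricting, at each vertex $\hat v$, to a bijection between the edges at $\hat v$ and the edges at $p(\hat v)$, such that $p^{-1}(C)$ is connected for every component $C$ of $G$. It is $r/2$-ball-preserving if it restricts to an isomorphism $B_{\hat G}(\hat v,r/2)\to B_G(p(\hat v),r/2)$ for every $\hat v$. The $r$-local covering $p_r\colon G_r\to G$ is the universal $r/2$-ball-preserving covering (every $r/2$-ball-preserving covering $p$ satisfies $p_r=p\circ q$ for some covering $q$), and $G_r$ is the $r$-local cover. *)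

theory Defs
  imports Main "HOL-Library.Extended_Nat"
begin

datatype 'v graph = Graph (verts: "'v set") (edges: "'v set set")

definition simple_graph :: "'v graph \<Rightarrow> bool" where
  "simple_graph G \<longleftrightarrow>
     (\<forall>e\<in>edges G. \<exists>u\<in>verts G. \<exists>v\<in>verts G. u \<noteq> v \<and> e = {u, v})"

definition induced :: "'v graph \<Rightarrow> 'v set \<Rightarrow> 'v graph" where
  "induced G X = Graph (verts G \<inter> X) {e \<in> edges G. e \<subseteq> X}"

definition incident :: "'v graph \<Rightarrow> 'v \<Rightarrow> 'v set set" where
  "incident G v = {e \<in> edges G. v \<in> e}"

definition graph_iso :: "'v graph \<Rightarrow> 'w graph \<Rightarrow> ('v \<Rightarrow> 'w) \<Rightarrow> bool" where
  "graph_iso H G f \<longleftrightarrow> bij_betw f (verts H) (verts G) \<and>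
     (\<forall>u\<in>verts H. \<forall>v\<in>verts H. {u, v} \<in> edges H \<longleftrightarrow> {f u, f v} \<in> edges G)"

definition walk :: "'v graph \<Rightarrow> 'v list \<Rightarrow> bool" where
  "walk G xs \<longleftrightarrow> xs \<noteq> [] \<and> set xs \<subseteq> verts G \<and>
     successively (\<lambda>x y. {x, y} \<in> edges G) xs"

definition walks_between :: "'v graph \<Rightarrow> 'v \<Rightarrow> 'v \<Rightarrow> 'v list set" where
  "walks_between G u v = {xs. walk G xs \<and> hd xs = u \<and> last xs = v}"

definition connected_graph :: "'v graph \<Rightarrow> bool" where
  "connected_graph G \<longleftrightarrow> verts G \<noteq> {} \<and>
     (\<forall>u\<in>verts G. \<forall>v\<in>verts G. walks_between G u v \<noteq> {})"

definition component :: "'v graph \<Rightarrow> 'v \<Rightarrow> 'v graph" where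
  "component G v = induced G {u. walks_between G v u \<noteq> {}}"

definition gdist :: "'v graph \<Rightarrow> 'v \<Rightarrow> 'v \<Rightarrow> enat" where
  "gdist G u v = (INF xs\<in>walks_between G u v. enat (length xs - 1))"


text \<open>A cycle is given by the cyclic sequence of its vertices.\<close>

definition cycle_edges :: "'v list \<Rightarrow> 'v set set" where
  "cycle_edges xs = {{xs ! i, xs ! (Suc i mod length xs)} | i. i < length xs}"

definition is_cycle :: "'v graph \<Rightarrow> 'v list \<Rightarrow> bool" where
  "is_cycle G xs \<longleftrightarrow> length xs \<ge> 3 \<and> distinct xs \<and> set xs \<subseteq> verts G \<and>
     cycle_edges xs \<subseteq> edges G"

definition has_chord :: "'v graph \<Rightarrow> 'v list \<Rightarrow> bool" where
  "has_chord G xs \<longleftrightarrow> (\<exists>e\<in>edges G. e \<subseteq> set xs \<and> e \<notin> cycle_edges xs)"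

definition chordal :: "'v graph \<Rightarrow> bool" where
  "chordal G \<longleftrightarrow> (\<forall>xs. is_cycle G xs \<and> 4 \<le> length xs \<longrightarrow> has_chord G xs)"

definition r_chordal :: "nat \<Rightarrow> 'v graph \<Rightarrow> bool" where
  "r_chordal r G \<longleftrightarrow>
     (\<forall>xs. is_cycle G xs \<and> 4 \<le> length xs \<and> length xs \<le> r \<longrightarrow> has_chord G xs)"

text \<open>The rim of the wheel is the cycle on \<open>0, \<dots>, n - 1\<close>, the hub is \<open>n\<close>.\<close>

definition wheel :: "nat \<Rightarrow> nat graph" where
  "wheel n = Graph {..n} ({{i, Suc i mod n} | i. i < n} \<union> {{i, n} | i. i < n})"

definition wheel_free :: "'v graph \<Rightarrow> bool" where
  "wheel_free G \<longleftrightarrow>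
     \<not> (\<exists>n\<ge>4. \<exists>X\<subseteq>verts G. \<exists>f. graph_iso (wheel n) (induced G X) f)"


text \<open>\<open>half_ball G v r\<close> is the ball of radius \<open>r/2\<close>; the condition
  \<open>gdist G v u \<le> r/2\<close> is multiplied by 2 to stay within extended naturals.\<close>

definition half_ball :: "'v graph \<Rightarrow> 'v \<Rightarrow> nat \<Rightarrow> 'v graph" where
  "half_ball G v r = Graph {u \<in> verts G. 2 * gdist G v u \<le> enat r}
     {e \<in> edges G. (\<Sum>u\<in>e. gdist G v u) < enat r}"

definition graph_hom :: "'v graph \<Rightarrow> 'w graph \<Rightarrow> ('v \<Rightarrow> 'w) \<Rightarrow> bool" where
  "graph_hom H G p \<longleftrightarrow> p ` verts H \<subseteq> verts G \<and> (\<forall>e\<in>edges H. p ` e \<in> edges G)"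

definition preimage_graph :: "'v graph \<Rightarrow> ('v \<Rightarrow> 'w) \<Rightarrow> 'w graph \<Rightarrow> 'v graph" where
  "preimage_graph H p C =
     Graph {v \<in> verts H. p v \<in> verts C} {e \<in> edges H. p ` e \<in> edges C}"

text \<open>A covering of a simple graph is automatically simple, since parallel edges at a
  vertex would have the same image. Surjectivity on edges follows from surjectivity on
  vertices and local bijectivity.\<close>

definition covering :: "'v graph \<Rightarrow> 'w graph \<Rightarrow> ('v \<Rightarrow> 'w) \<Rightarrow> bool" where
  "covering H G p \<longleftrightarrow> simple_graph H \<and> simple_graph G \<and>
     graph_hom H G p \<and> p ` verts H = verts G \<and>
     (\<forall>v\<in>verts H. bij_betw (image p) (incident H v) (incident G (p v))) \<and>
     (\<forall>w\<in>verts G. connected_graph (preimage_graph H p (component G w)))"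

definition ball_preserving_covering ::
    "nat \<Rightarrow> 'v graph \<Rightarrow> 'w graph \<Rightarrow> ('v \<Rightarrow> 'w) \<Rightarrow> bool" where
  "ball_preserving_covering r H G p \<longleftrightarrow> covering H G p \<and>
     (\<forall>v\<in>verts H. graph_iso (half_ball H v r) (half_ball G (p v) r) p)"

text \<open>\<open>local_covering r Gr G pr\<close>: \<open>pr\<close> is the \<open>r\<close>-local covering of \<open>G\<close>, and \<open>Gr\<close> its
  \<open>r\<close>-local cover. A formula cannot quantify over the vertex type of the competing
  coverings \<open>p\<close>, so they are taken with vertices in \<open>'v list\<close>, where \<open>'v\<close> is the vertex
  type of \<open>G\<close>. This is no restriction: every covering of \<open>G\<close> has an isomorphic copy
  there, so universality over all types follows (lemma \<open>local_covering_universal\<close>).\<close>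

definition local_covering :: "nat \<Rightarrow> 'w graph \<Rightarrow> 'v graph \<Rightarrow> ('w \<Rightarrow> 'v) \<Rightarrow> bool" where
  "local_covering r Gr G pr \<longleftrightarrow> ball_preserving_covering r Gr G pr \<and>
     (\<forall>(H :: 'v list graph) p. ball_preserving_covering r H G p \<longrightarrow>
        (\<exists>q. covering Gr H q \<and> (\<forall>v\<in>verts Gr. pr v = p (q v))))"


lemma simple_graph_edge_subset: "simple_graph G \<Longrightarrow> e \<in> edges G \<Longrightarrow> e \<subseteq> verts G"
  unfolding simple_graph_def by fastforce

lemma graph_iso_edges:
  assumes "graph_iso A B f" "simple_graph A" "simple_graph B"
  shows "bij_betw (image f) (edges A) (edges B)"
proof -
  have inj: "inj_on f (verts A)" and im: "f ` verts A = verts B"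
    using assms(1) by (auto simp: graph_iso_def bij_betw_def)
  have e: "{u,v} \<in> edges A \<longleftrightarrow> {f u, f v} \<in> edges B" if "u \<in> verts A" "v \<in> verts A" for u v
    using assms(1) that by (auto simp: graph_iso_def)
  have "inj_on (image f) (edges A)"
    by (rule inj_onI)
      (metis inj inj_on_image_eq_iff simple_graph_edge_subset[OF assms(2)])
  moreover have "image f ` edges A \<subseteq> edges B"
  proof (clarify)
    fix d assume d: "d \<in> edges A"
    obtain u v where uv: "u \<in> verts A" "v \<in> verts A" "d = {u,v}"
      using assms(2) d unfolding simple_graph_def by metis
    then show "f ` d \<in> edges B" using e d by auto
  qed
  moreover have "edges B \<subseteq> image f ` edges A"
  proof
    fix d assume d: "d \<in> edges B"
    obtain u v where uv: "u \<in> verts B" "v \<in> verts B" "d = {u,v}"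
      using assms(3) d unfolding simple_graph_def by metis
    then obtain x y where xy: "x \<in> verts A" "y \<in> verts A" "u = f x" "v = f y"
      using im by blast
    then have "{x,y} \<in> edges A" "d = f ` {x,y}" using e uv d by auto
    then show "d \<in> image f ` edges A" by blast
  qed
  ultimately show ?thesis unfolding bij_betw_def by blast
qed

lemma graph_iso_hom:
  assumes "graph_iso A B f" "simple_graph A" "simple_graph B"
  shows "graph_hom A B f"
  using assms graph_iso_edges[OF assms]
  unfolding graph_hom_def graph_iso_def bij_betw_def by blast

lemma graph_iso_inv:
  assumes "graph_iso A B f"
  shows "graph_iso B A (inv_into (verts A) f)"
proof -
  let ?g = "inv_into (verts A) f"
  have b: "bij_betw f (verts A) (verts B)" using assms by (simp add: graph_iso_def)
  then have g: "bij_betw ?g (verts B) (verts A)" by (rule bij_betw_inv_into)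
  have "{u, v} \<in> edges B \<longleftrightarrow> {?g u, ?g v} \<in> edges A" if "u \<in> verts B" "v \<in> verts B" for u v
  proof -
    have "f (?g u) = u" "f (?g v) = v" using b that by (auto simp: bij_betw_inv_into_right)
    moreover have "?g u \<in> verts A" "?g v \<in> verts A" using g that by (auto dest: bij_betwE)
    ultimately show ?thesis using assms unfolding graph_iso_def by metis
  qed
  then show ?thesis using g unfolding graph_iso_def by blast
qed

lemma graph_iso_comp:
  assumes "graph_iso A B f" "graph_iso B C g"
  shows "graph_iso A C (g \<circ> f)"
  using assms bij_betw_trans[of f "verts A" "verts B" g "verts C"]
  unfolding graph_iso_def by (auto dest: bij_betwE)

lemma walk_map:
  assumes "graph_hom A B f" "walk A xs"
  shows "walk B (map f xs)"
proof -
  have "successively (\<lambda>x y. {f x, f y} \<in> edges B) xs"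
  proof (rule successively_mono)
    show "successively (\<lambda>x y. {x, y} \<in> edges A) xs" using assms(2) by (simp add: walk_def)
    fix x y assume "{x, y} \<in> edges A"
    then have "f ` {x, y} \<in> edges B" using assms(1) unfolding graph_hom_def by blast
    then show "{f x, f y} \<in> edges B" by simp
  qed
  then show ?thesis
    using assms unfolding walk_def graph_hom_def by (auto simp: successively_map)
qed

lemma walks_between_map:
  assumes "graph_hom A B f" "xs \<in> walks_between A u v"
  shows "map f xs \<in> walks_between B (f u) (f v)"
  using assms walk_map[OF assms(1)]
  by (auto simp: walks_between_def walk_def hd_map last_map)

lemma gdist_hom_le:
  assumes "graph_hom A B f"
  shows "gdist B (f u) (f v) \<le> gdist A u v"
  unfolding gdist_def
proof (rule INF_mono)
  fix xs assume "xs \<in> walks_between A u v"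
  then show "\<exists>ys\<in>walks_between B (f u) (f v). enat (length ys - 1) \<le> enat (length xs - 1)"
    using walks_between_map[OF assms] by (intro bexI[of _ "map f xs"]) auto
qed

lemma gdist_iso:
  assumes "graph_iso A B f" "simple_graph A" "simple_graph B" "u \<in> verts A" "v \<in> verts A"
  shows "gdist B (f u) (f v) = gdist A u v"
proof (rule antisym)
  show "gdist B (f u) (f v) \<le> gdist A u v"
    by (rule gdist_hom_le[OF graph_iso_hom[OF assms(1-3)]])
  have inj: "inj_on f (verts A)" using assms(1) by (auto simp: graph_iso_def bij_betw_def)
  have "graph_hom B A (inv_into (verts A) f)"
    by (rule graph_iso_hom[OF graph_iso_inv[OF assms(1)] assms(3,2)])
  from gdist_hom_le[OF this, of "f u" "f v"]
  show "gdist A u v \<le> gdist B (f u) (f v)" using inj assms(4,5) by simp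
qed

lemma half_ball_iso:
  assumes "graph_iso A B f" "simple_graph A" "simple_graph B" "v \<in> verts A"
  shows "graph_iso (half_ball A v r) (half_ball B (f v) r) f"
proof -
  have inj: "inj_on f (verts A)" and im: "f ` verts A = verts B"
    using assms(1) by (auto simp: graph_iso_def bij_betw_def)
  note d = gdist_iso[OF assms(1-4)]
  have "bij_betw f (verts (half_ball A v r)) (verts (half_ball B (f v) r))"
  proof -
    have "f ` {u \<in> verts A. 2 * gdist A v u \<le> enat r} = {u \<in> verts B. 2 * gdist B (f v) u \<le> enat r}"
      unfolding im[symmetric] using d by auto
    then show ?thesis
      unfolding bij_betw_def half_ball_def using inj by (auto intro: inj_on_subset)
  qed
  moreover have "{x,y} \<in> edges (half_ball A v r) \<longleftrightarrow> {f x, f y} \<in> edges (half_ball B (f v) r)"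
    if xy: "x \<in> verts A" "y \<in> verts A" for x y
  proof -
    have "(\<Sum>u\<in>f ` {x,y}. gdist B (f v) u) = (\<Sum>u\<in>{x,y}. gdist B (f v) (f u))"
      using sum.reindex[OF inj_on_subset[OF inj], of "{x,y}" "gdist B (f v)"] xy by (simp add: comp_def del: image_insert)
    also have "\<dots> = (\<Sum>u\<in>{x,y}. gdist A v u)" using xy d by (intro sum.cong) auto
    finally show ?thesis
      using assms(1) xy unfolding half_ball_def graph_iso_def by auto
  qed
  ultimately show ?thesis unfolding graph_iso_def by (auto simp: half_ball_def)
qed

lemma graph_iso_incident:
  assumes "graph_iso A B f" "simple_graph A" "simple_graph B" "v \<in> verts A"
  shows "bij_betw (image f) (incident A v) (incident B (f v))"
proof -
  have inj: "inj_on f (verts A)" using assms(1) by (auto simp: graph_iso_def bij_betw_def)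
  have bij: "bij_betw (image f) (edges A) (edges B)" by (rule graph_iso_edges[OF assms(1-3)])
  have mem: "f v \<in> f ` e \<longleftrightarrow> v \<in> e" if "e \<in> edges A" for e
    using inj_on_image_mem_iff[OF inj assms(4) simple_graph_edge_subset[OF assms(2) that]] .
  have "inj_on (image f) (incident A v)"
    using bij unfolding bij_betw_def incident_def by (auto intro: inj_on_subset)
  moreover have "image f ` incident A v = incident B (f v)"
  proof -
    have im: "edges B = image f ` edges A" using bij by (simp add: bij_betw_def)
    show ?thesis unfolding incident_def im using mem by auto
  qed
  ultimately show ?thesis unfolding bij_betw_def by blast
qed

lemma connected_graph_hom_image:
  assumes "connected_graph A" "graph_hom A B f" "f ` verts A = verts B"
  shows "connected_graph B"
  unfolding connected_graph_def
proof (intro conjI ballI)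
  show "verts B \<noteq> {}" using assms by (auto simp: connected_graph_def)
  fix u v assume "u \<in> verts B" "v \<in> verts B"
  then obtain x y where "x \<in> verts A" "y \<in> verts A" "u = f x" "v = f y"
    using assms(3) by blast
  moreover from this obtain xs where "xs \<in> walks_between A x y"
    using assms(1) unfolding connected_graph_def by blast
  ultimately show "walks_between B u v \<noteq> {}" using walks_between_map[OF assms(2)] by blast
qed

lemma covering_precomp_iso:
  assumes c: "covering H G p" and g: "graph_iso K H g" and K: "simple_graph K"
  shows "covering K G (p \<circ> g)"
proof -
  have H: "simple_graph H" and G: "simple_graph G" and hom: "graph_hom H G p"
    and sur: "p ` verts H = verts G"
    using c by (auto simp: covering_def)
  have gh: "graph_hom K H g" by (rule graph_iso_hom[OF g K H])
  have gb: "bij_betw g (verts K) (verts H)" using g by (simp add: graph_iso_def)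
  let ?h = "inv_into (verts K) g"
  have h: "graph_iso H K ?h" by (rule graph_iso_inv[OF g])
  have hh: "graph_hom H K ?h" by (rule graph_iso_hom[OF h H K])
  have gi: "g (?h x) = x" if "x \<in> verts H" for x
    using gb that by (simp add: bij_betw_inv_into_right)
  have gie: "g ` ?h ` e = e" if "e \<in> edges H" for e
  proof -
    have "\<And>x. x \<in> e \<Longrightarrow> g (?h x) = x" using gi simple_graph_edge_subset[OF H that] by blast
    then show ?thesis by (force simp: image_image)
  qed
  have "graph_hom K G (p \<circ> g)"
    using hom gh unfolding graph_hom_def image_comp[symmetric] by blast
  moreover have "(p \<circ> g) ` verts K = verts G"
    using sur gb unfolding image_comp[symmetric] bij_betw_def by simp
  moreover have "bij_betw (image (p \<circ> g)) (incident K v) (incident G ((p \<circ> g) v))"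
    if v: "v \<in> verts K" for v
  proof -
    have "g v \<in> verts H" using v gb by (auto dest: bij_betwE)
    then have "bij_betw (image p) (incident H (g v)) (incident G (p (g v)))"
      using c by (simp add: covering_def)
    from bij_betw_trans[OF graph_iso_incident[OF g K H v] this]
    show ?thesis by (simp add: comp_def image_image)
  qed
  moreover have "connected_graph (preimage_graph K (p \<circ> g) (component G w))"
    if w: "w \<in> verts G" for w
  proof (rule connected_graph_hom_image)
    let ?C = "component G w"
    show "connected_graph (preimage_graph H p ?C)" using c w by (simp add: covering_def)
    show "?h ` verts (preimage_graph H p ?C) = verts (preimage_graph K (p \<circ> g) ?C)"
    proof (intro equalityI subsetI)
      fix x assume "x \<in> ?h ` verts (preimage_graph H p ?C)"
      then show "x \<in> verts (preimage_graph K (p \<circ> g) ?C)"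
        using gi hh by (auto simp: preimage_graph_def graph_hom_def)
    next
      fix x assume x: "x \<in> verts (preimage_graph K (p \<circ> g) ?C)"
      then have "?h (g x) = x" "g x \<in> verts H"
        using gb by (auto simp: preimage_graph_def bij_betw_inv_into_left dest: bij_betwE)
      then show "x \<in> ?h ` verts (preimage_graph H p ?C)"
        using x by (auto simp: preimage_graph_def intro!: image_eqI[of x ?h "g x"])
    qed
    then show "graph_hom (preimage_graph H p ?C) (preimage_graph K (p \<circ> g) ?C) ?h"
      using hh gie unfolding graph_hom_def preimage_graph_def image_comp[symmetric] by simp
  qed
  ultimately show ?thesis using K G unfolding covering_def by blast
qed

lemma covering_postcomp_iso:
  assumes c: "covering A K q" and g: "graph_iso K H g" and H: "simple_graph H"
  shows "covering A H (g \<circ> q)"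
proof -
  have A: "simple_graph A" and K: "simple_graph K" and hom: "graph_hom A K q"
    and sur: "q ` verts A = verts K"
    using c by (auto simp: covering_def)
  have gh: "graph_hom K H g" by (rule graph_iso_hom[OF g K H])
  have gb: "bij_betw g (verts K) (verts H)" using g by (simp add: graph_iso_def)
  have ge: "bij_betw (image g) (edges K) (edges H)" by (rule graph_iso_edges[OF g K H])
  let ?h = "inv_into (verts K) g"
  have hh: "graph_hom H K ?h" by (rule graph_iso_hom[OF graph_iso_inv[OF g] H K])
  have hi: "?h (g x) = x" if "x \<in> verts K" for x
    using gb that by (simp add: bij_betw_inv_into_left)
  have "graph_hom A H (g \<circ> q)"
    using hom gh unfolding graph_hom_def image_comp[symmetric] by blast
  moreover have "(g \<circ> q) ` verts A = verts H"
    using sur gb unfolding image_comp[symmetric] bij_betw_def by simp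
  moreover have "bij_betw (image (g \<circ> q)) (incident A v) (incident H ((g \<circ> q) v))"
    if v: "v \<in> verts A" for v
  proof -
    have "q v \<in> verts K" using v sur by blast
    moreover have "bij_betw (image q) (incident A v) (incident K (q v))"
      using c v by (simp add: covering_def)
    ultimately have "bij_betw (image g \<circ> image q) (incident A v) (incident H (g (q v)))"
      using bij_betw_trans[OF _ graph_iso_incident[OF g K H]] by blast
    then show ?thesis by (simp add: comp_def image_image)
  qed
  moreover have "connected_graph (preimage_graph A (g \<circ> q) (component H w))"
    if w: "w \<in> verts H" for w
  proof -
    obtain z where z: "z \<in> verts K" "w = g z" using w gb by (auto simp: bij_betw_def)
    have r: "walks_between H w (g u) \<noteq> {} \<longleftrightarrow> walks_between K z u \<noteq> {}" if "u \<in> verts K" for u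
    proof -
      have "?h w = z" "?h (g u) = u" using hi z that by auto
      then show ?thesis
        using walks_between_map[OF gh, of _ z u] walks_between_map[OF hh, of _ w "g u"] z(2)
        by (metis equals0D equals0I)
    qed
    have vq: "g (q v) \<in> verts (component H w) \<longleftrightarrow> q v \<in> verts (component K z)" if "v \<in> verts A" for v
    proof -
      have "q v \<in> verts K" "g (q v) \<in> verts H" using that sur gb by (auto dest: bij_betwE)
      then show ?thesis using r by (simp add: component_def induced_def)
    qed
    have eq: "g ` q ` e \<in> edges (component H w) \<longleftrightarrow> q ` e \<in> edges (component K z)"
      if "e \<in> edges A" for e
    proof -
      have "q ` e \<in> edges K" using that hom by (auto simp: graph_hom_def)
      moreover from this have "g ` q ` e \<in> edges H" using gh by (auto simp: graph_hom_def)
      moreover have "\<And>x. x \<in> e \<Longrightarrow> q x \<in> verts K"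
        using simple_graph_edge_subset[OF K] \<open>q ` e \<in> edges K\<close> by blast
      ultimately show ?thesis using r by (simp add: component_def induced_def image_subset_iff)
    qed
    have "preimage_graph A (g \<circ> q) (component H w) = preimage_graph A q (component K z)"
      using vq eq unfolding preimage_graph_def image_comp[symmetric] comp_apply by (auto simp del: image_comp)
    then show ?thesis using c z by (simp add: covering_def)
  qed
  ultimately show ?thesis using A H unfolding covering_def by blast
qed

lemma covering_unique_walk_lifting:
  assumes "covering H G p"
  shows "walk H xs \<Longrightarrow> walk H ys \<Longrightarrow> hd xs = hd ys \<Longrightarrow> map p xs = map p ys \<Longrightarrow> xs = ys"
proof (induction xs arbitrary: ys)
  case Nil
  then show ?case by simp
next
  case (Cons x xs)
  then obtain ys' where ys: "ys = x # ys'" by (cases ys) (auto simp: walk_def)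
  show ?case
  proof (cases xs)
    case Nil
    then show ?thesis using Cons ys by simp
  next
    case xs: (Cons a as)
    then obtain b bs where ys': "ys' = b # bs" using Cons.prems ys by (cases ys') auto
    have x: "x \<in> verts H" and e: "{x,a} \<in> edges H" "{x,b} \<in> edges H"
      and w: "walk H xs" "walk H ys'" and pab: "p a = p b"
      using Cons.prems ys ys' xs by (auto simp: walk_def)
    have "inj_on (image p) (incident H x)"
      using assms x by (auto simp: covering_def bij_betw_def)
    moreover have "{x,a} \<in> incident H x" "{x,b} \<in> incident H x" using e by (auto simp: incident_def)
    moreover have "p ` {x,a} = p ` {x,b}" using pab by simp
    ultimately have "{x,a} = {x,b}" by (meson inj_onD)
    then have "a = b" by (auto simp: doubleton_eq_iff)
    then show ?thesis using Cons.IH[OF w] Cons.prems ys ys' xs by simp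
  qed
qed

lemma covering_inj_list:
  fixes G :: "'v graph"
  assumes c: "covering H G p"
  shows "\<exists>f :: 'w \<Rightarrow> 'v list. inj_on f (verts (H :: 'w graph))"
proof -
  have G: "simple_graph G" and hom: "graph_hom H G p" and sur: "p ` verts H = verts G"
    using c by (auto simp: covering_def)
  define rt where "rt v = (SOME u. u \<in> verts H \<and> p u \<in> verts (component G (p v)))" for v
  define wk where "wk v = (SOME xs. xs \<in> walks_between H (rt v) v)" for v
  have self: "[v] \<in> walks_between G v v" if "v \<in> verts G" for v
    using that by (auto simp: walks_between_def walk_def)
  have inC: "p v \<in> verts (component G (p v))" if "v \<in> verts H" for v
    using self[of "p v"] that sur by (auto simp: component_def induced_def)
  have rt: "rt v \<in> verts H \<and> p (rt v) \<in> verts (component G (p v))" if "v \<in> verts H" for v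
    unfolding rt_def by (rule someI[of _ v]) (use inC that in auto)
  have wk: "wk v \<in> walks_between H (rt v) v" if v: "v \<in> verts H" for v
  proof -
    let ?P = "preimage_graph H p (component G (p v))"
    have "connected_graph ?P" using c v sur by (auto simp: covering_def)
    then have "walks_between ?P (rt v) v \<noteq> {}"
      using rt[OF v] inC[OF v] v by (auto simp: connected_graph_def preimage_graph_def)
    then obtain xs where "xs \<in> walks_between ?P (rt v) v" by blast
    moreover have "graph_hom ?P H id" by (auto simp: graph_hom_def preimage_graph_def)
    ultimately have "xs \<in> walks_between H (rt v) v"
      using walks_between_map[of ?P H id xs "rt v" v] by simp
    then show ?thesis unfolding wk_def by (rule someI)
  qed
  have app: "walks_between G a d \<noteq> {}"
    if ab: "walks_between G a b \<noteq> {}" and bd: "walks_between G b d \<noteq> {}" for a b d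
  proof -
    obtain xs ys where xs: "xs \<in> walks_between G a b" and ys: "ys \<in> walks_between G b d"
      using ab bd by blast
    show ?thesis
    proof (cases "tl ys")
      case Nil
      then have "ys = [b]" "b = d"
        using ys by (cases ys; auto simp: walks_between_def walk_def)+
      then show ?thesis using ab by simp
    next
      case (Cons z zs)
      then have "ys = b # z # zs" using ys by (cases ys) (auto simp: walks_between_def walk_def)
      then have "xs @ z # zs \<in> walks_between G a d"
        using xs ys by (auto simp: walks_between_def walk_def successively_append_iff)
      then show ?thesis by blast
    qed
  qed
  have rev: "walks_between G b a \<noteq> {}" if ab: "walks_between G a b \<noteq> {}" for a b
  proof -
    obtain xs where "xs \<in> walks_between G a b" using ab by blast
    then have "rev xs \<in> walks_between G b a"
      by (auto simp: walks_between_def walk_def hd_rev last_rev insert_commute)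
    then show ?thesis by blast
  qed
  have "inj_on (\<lambda>v. map p (wk v)) (verts H)"
  proof (rule inj_onI)
    fix u v assume u: "u \<in> verts H" and v: "v \<in> verts H" and eq: "map p (wk u) = map p (wk v)"
    have ne: "wk u \<noteq> []" "wk v \<noteq> []"
      using wk[OF u] wk[OF v] by (auto simp: walks_between_def walk_def)
    have "p (rt u) = p (rt v)"
      using eq ne wk[OF u] wk[OF v] by (metis (mono_tags, lifting) hd_map mem_Collect_eq walks_between_def)
    then have a: "walks_between G (p u) (p (rt u)) \<noteq> {}" "walks_between G (p v) (p (rt u)) \<noteq> {}"
      using rt[OF u] rt[OF v] by (auto simp: component_def induced_def)
    then have "walks_between G (p u) d \<noteq> {} \<longleftrightarrow> walks_between G (p v) d \<noteq> {}" for d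
      using app rev by meson
    then have "component G (p u) = component G (p v)" by (simp add: component_def)
    then have "rt u = rt v" by (simp add: rt_def)
    then have "wk u = wk v"
      using covering_unique_walk_lifting[OF c] wk[OF u] wk[OF v] eq by (auto simp: walks_between_def)
    then show "u = v" using wk[OF u] wk[OF v] by (auto simp: walks_between_def)
  qed
  then show ?thesis by blast
qed

lemma local_covering_universal:
  fixes G :: "'v graph" and H :: "'u graph"
  assumes l: "local_covering r Gr G pr" and b: "ball_preserving_covering r H G p"
  shows "\<exists>q. covering Gr H q \<and> (\<forall>v\<in>verts Gr. pr v = p (q v))"
proof -
  have c: "covering H G p" using b by (simp add: ball_preserving_covering_def)
  then have H: "simple_graph H" by (simp add: covering_def)
  obtain f :: "'u \<Rightarrow> 'v list" where f: "inj_on f (verts H)" using covering_inj_list[OF c] by blast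
  define K where "K = Graph (f ` verts H) (image f ` edges H)"
  have K: "simple_graph K"
    unfolding simple_graph_def
  proof
    fix d assume "d \<in> edges K"
    then obtain e where e: "e \<in> edges H" "d = f ` e" by (auto simp: K_def)
    then obtain u v where "u \<in> verts H" "v \<in> verts H" "u \<noteq> v" "e = {u,v}"
      using H unfolding simple_graph_def by metis
    then show "\<exists>u\<in>verts K. \<exists>v\<in>verts K. u \<noteq> v \<and> d = {u, v}"
      using e f by (auto simp: K_def inj_on_def)
  qed
  have fi: "graph_iso H K f"
    unfolding graph_iso_def
  proof (intro conjI ballI)
    show "bij_betw f (verts H) (verts K)" using f by (simp add: K_def bij_betw_def)
    fix u v assume uv: "u \<in> verts H" "v \<in> verts H"
    have "f ` {u,v} = f ` e \<longleftrightarrow> {u,v} = e" if "e \<in> edges H" for e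
      using f simple_graph_edge_subset[OF H that] uv by (intro inj_on_image_eq_iff) auto
    then show "{u, v} \<in> edges H \<longleftrightarrow> {f u, f v} \<in> edges K"
      by (auto simp: K_def image_iff)
  qed
  let ?g = "inv_into (verts H) f"
  have g: "graph_iso K H ?g" by (rule graph_iso_inv[OF fi])
  have "ball_preserving_covering r K G (p \<circ> ?g)"
    unfolding ball_preserving_covering_def
  proof (intro conjI ballI)
    show "covering K G (p \<circ> ?g)" by (rule covering_precomp_iso[OF c g K])
    fix v assume v: "v \<in> verts K"
    then have "?g v \<in> verts H" using g by (auto simp: graph_iso_def dest: bij_betwE)
    then have "graph_iso (half_ball H (?g v) r) (half_ball G (p (?g v)) r) p"
      using b by (simp add: ball_preserving_covering_def)
    from graph_iso_comp[OF half_ball_iso[OF g K H v] this]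
    show "graph_iso (half_ball K v r) (half_ball G ((p \<circ> ?g) v) r) (p \<circ> ?g)" by simp
  qed
  then obtain q where q: "covering Gr K q" "\<forall>v\<in>verts Gr. pr v = (p \<circ> ?g) (q v)"
    using l unfolding local_covering_def by blast
  have "covering Gr H (?g \<circ> q)" by (rule covering_postcomp_iso[OF q(1) g H])
  then show ?thesis using q(2) by auto
qed

end

theory Submission
  imports Defs
begin

text \<open>
  Call a closed walk, read as a polygon, fillable if it has a triangulation without interior vertices
  whose edges map to edges or to single vertices. In a wheel-free graph fillability survives the
  deletion of a vertex \<open>y\<close> whose two neighbours on the polygon coincide or are adjacent: the other ends
  of the triangulation edges at \<open>y\<close> form a closed walk in the closed neighbourhood of \<open>y\<close>, which
  contains no chordless cycle of length at least 4, so this walk is fillable and closes the gap.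
  Hence fillability is invariant under homotopies through triangles, and, if the graph is also
  \<open>r\<close>-chordal, under homotopies through closed walks of length at most \<open>r\<close>.
  Walks in \<open>G\<close> modulo the latter homotopies form an \<open>r/2\<close>-ball-preserving covering of \<open>G\<close>. By
  universality every closed walk in \<open>G\<^sub>r\<close> projects to a null-homotopic one; since short closed walks
  lift to closed walks, the homotopy lifts to \<open>G\<^sub>r\<close> and the closed walk is fillable. A
  chordless cycle of length at least 4 is not fillable.
\<close>

section \<open>Fillable polygons\<close>

definition near :: "'v graph \<Rightarrow> 'v \<Rightarrow> 'v \<Rightarrow> bool" where
  "near G x y \<longleftrightarrow> x \<in> verts G \<and> y \<in> verts G \<and> (x = y \<or> {x, y} \<in> edges G)"

lemma near_sym: "near G x y \<Longrightarrow> near G y x"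
  by (auto simp: near_def insert_commute)

lemma near_refl: "near G x y \<Longrightarrow> near G x x" "near G x y \<Longrightarrow> near G y y"
  by (auto simp: near_def)

text \<open>A list is read as a polygon whose closing side joins its last entry to its head. The
  rule \<open>edge\<close> is the degenerate polygon with two corners; \<open>glue\<close> puts the
  triangle \<open>hd xs\<close>, \<open>b\<close>, \<open>last ys\<close> on the closing side and
  triangulates what lies beyond its two other sides.\<close>

inductive fillable :: "'v graph \<Rightarrow> 'v list \<Rightarrow> bool" for G where
  edge: "near G a b \<Longrightarrow> fillable G [a, b]"
| glue: "fillable G (xs @ [b]) \<Longrightarrow> fillable G (b # ys) \<Longrightarrow> near G (hd xs) (last ys) \<Longrightarrow>
    fillable G (xs @ b # ys)"

lemma fillable_length: "fillable G L \<Longrightarrow> 2 \<le> length L"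
  by (induction rule: fillable.induct) auto

lemma fillable_near_ends: "fillable G L \<Longrightarrow> near G (hd L) (last L)"
proof (induction rule: fillable.induct)
  case (glue xs b ys)
  then have "xs \<noteq> []" "ys \<noteq> []" using fillable_length by fastforce+
  then show ?case using glue by simp
qed simp

lemma fillable_successively: "fillable G L \<Longrightarrow> successively (near G) L"
  by (induction rule: fillable.induct) (auto simp: successively_append_iff successively_Cons)

lemma fillable_rev: "fillable G L \<Longrightarrow> fillable G (rev L)"
proof (induction rule: fillable.induct)
  case (edge a b)
  then show ?case using fillable.edge[of G b a] near_sym by fastforce
next
  case (glue xs b ys)
  then show ?case
    using fillable.glue[of G "rev ys" b "rev xs"] near_sym[OF glue(3)] by (auto simp: hd_rev last_rev)
qed

lemma fillable_triangle:
  assumes "near G x y" "near G y z" "near G x z"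
  shows "fillable G [x, y, z]"
proof -
  have "fillable G ([x] @ [y])" "fillable G (y # [z])" using assms by (simp_all add: fillable.edge)
  from fillable.glue[OF this] show ?thesis using assms by simp
qed

lemma fillable_join:
  assumes "fillable G A" "fillable G B" "last A = hd B" "near G (hd A) (last B)"
  shows "fillable G (A @ tl B)"
proof -
  obtain xs b ys where "A = xs @ [b]" "B = b # ys" "xs \<noteq> []" "ys \<noteq> []"
    using fillable_length[OF assms(1)] fillable_length[OF assms(2)] assms(3)
    by (cases A rule: rev_cases; cases B) (auto simp: Suc_le_eq)
  then show ?thesis using fillable.glue[of G xs b ys] assms by simp
qed

text \<open>The lists \<open>xs @ [b]\<close> and \<open>b # ys\<close> overlap in \<open>b\<close>,
  so two consecutive entries lie together in one of them. This locates the piece of a triangulation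
  that contains a given side.\<close>

lemma append_pair_cases:
  assumes "xs @ b # ys = ps @ x # z # qs"
  obtains q where "xs @ [b] = ps @ x # z # q" "qs = q @ ys"
  | p where "ps = xs @ p" "b # ys = p @ x # z # qs"
proof (cases "length xs \<le> length ps")
  case True
  then have "ps = xs @ drop (length xs) ps"
    using arg_cong[OF assms, of "take (length xs)"] append_take_drop_id[of "length xs" ps] by simp
  moreover from this have "b # ys = drop (length xs) ps @ x # z # qs"
    using assms by (metis append.assoc same_append_eq)
  ultimately show thesis using that(2) by blast
next
  case False
  then have "xs = ps @ drop (length ps) xs" "drop (length ps) xs \<noteq> []"
    using arg_cong[OF assms, of "take (length ps)"] append_take_drop_id[of "length ps" xs] by simp_all
  then obtain y' t where "xs = ps @ y' # t" by (metis neq_Nil_conv)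
  then show thesis using that(1) assms by (cases t) auto
qed

text \<open>The third outcome is the apex case: the middle entry is the shared vertex
  \<open>b\<close>.\<close>

lemma append_triple_cases:
  assumes "xs @ b # ys = ps @ x # y # z # qs"
  obtains q where "xs @ [b] = ps @ x # y # z # q" "qs = q @ ys"
  | p where "ps = xs @ p" "b # ys = p @ x # y # z # qs"
  | "xs = ps @ [x]" "b = y" "ys = z # qs"
proof (cases rule: append_pair_cases[OF assms])
  case (1 q)
  then show thesis using that(1)[of "tl q"] that(3) by (cases q) auto
next
  case (2 p)
  then show thesis using that(2) by blast
qed

text \<open>The induction follows the side from \<open>x\<close> to \<open>z\<close> into the piece
  that has it, down to the two-cornered polygon \<open>[x, z]\<close>, which is replaced by the
  second triangulation. The ends of each piece are kept, so the same triangles glue the pieces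
  together again.\<close>

lemma fillable_subst:
  assumes "fillable G (ps @ x # z # qs)" "fillable G (x # m @ [z])"
  shows "fillable G (ps @ x # m @ z # qs)"
  using assms(1)
proof (induction "ps @ x # z # qs" arbitrary: ps qs rule: fillable.induct)
  case (edge a b)
  then show ?case using assms(2) by (auto simp: append_eq_Cons_conv Cons_eq_append_conv)
next
  case (glue xs b ys)
  have ne: "xs \<noteq> []" "ys \<noteq> []"
    using fillable_length[OF glue.hyps(1)] fillable_length[OF glue.hyps(3)] by auto
  show ?case using glue.hyps(6)
  proof (cases rule: append_pair_cases)
    case (1 q)
    have "hd (ps @ x # m @ z # q) = hd xs" "last (ps @ x # m @ z # q) = b"
      using arg_cong[OF 1(1), of hd] arg_cong[OF 1(1), of last] ne by (auto simp: hd_append split: if_splits)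
    then have "fillable G ((ps @ x # m @ z # q) @ tl (b # ys))"
      using glue.hyps(2)[OF 1(1)] glue.hyps(3,5) ne by (intro fillable_join) simp_all
    then show ?thesis using 1(2) by simp
  next
    case (2 p)
    let ?B = "p @ x # m @ z # qs"
    have h: "hd ?B = b" "last ?B = last ys" "?B \<noteq> []"
      using arg_cong[OF 2(2), of hd] arg_cong[OF 2(2), of last] ne by (auto simp: hd_append split: if_splits)
    then have "fillable G ((xs @ [b]) @ tl ?B)"
      using glue.hyps(4)[OF 2(2)] glue.hyps(1,5) ne by (intro fillable_join) simp_all
    moreover have "b # tl ?B = ?B" using h by (metis list.collapse)
    ultimately show ?thesis using 2(1) by (metis append.assoc append_Cons append_Nil)
  qed
qed

section \<open>Chordless cycles and the filling of closed walks\<close>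

lemma nonconsecutive_split:
  assumes "Suc i < j" "j < length f"
  shows "\<exists>A B C. f = A @ f ! i # B @ f ! j # C \<and> B \<noteq> [] \<and> length A = i \<and> length C = length f - Suc j"
proof -
  let ?B = "drop (Suc i) (take j f)"
  have "f = take j f @ f ! j # drop (Suc j) f" using assms by (simp add: id_take_nth_drop)
  moreover have "take j f = take i f @ f ! i # ?B"
    using assms id_take_nth_drop[of i "take j f"] by (simp add: min_def)
  ultimately have "f = take i f @ f ! i # ?B @ f ! j # drop (Suc j) f"
    by (metis append.assoc append_Cons)
  moreover have "?B \<noteq> []" using assms by simp
  moreover have "length (take i f) = i" "length (drop (Suc j) f) = length f - Suc j" using assms by auto
  ultimately show ?thesis by blast
qed

lemma cycle_edges_nth:
  assumes "distinct xs" "i < j" "j < length xs"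
  shows "{xs ! i, xs ! j} \<in> cycle_edges xs \<longleftrightarrow> j = Suc i \<or> i = 0 \<and> j = length xs - 1"
proof
  assume "{xs ! i, xs ! j} \<in> cycle_edges xs"
  then obtain k where k: "k < length xs" "{xs ! i, xs ! j} = {xs ! k, xs ! (Suc k mod length xs)}"
    by (auto simp: cycle_edges_def)
  have "Suc k mod length xs < length xs" using k(1) by (intro mod_less_divisor) linarith
  then have "i = k \<and> j = Suc k mod length xs \<or> j = k \<and> i = Suc k mod length xs"
    using k assms by (auto simp: doubleton_eq_iff nth_eq_iff_index_eq)
  then show "j = Suc i \<or> i = 0 \<and> j = length xs - 1"
    using k(1) assms by (cases "Suc k = length xs") auto
next
  assume "j = Suc i \<or> i = 0 \<and> j = length xs - 1"
  then show "{xs ! i, xs ! j} \<in> cycle_edges xs"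
  proof
    assume "j = Suc i"
    then show ?thesis using assms unfolding cycle_edges_def by (intro CollectI exI[of _ i]) auto
  next
    assume "i = 0 \<and> j = length xs - 1"
    then have "Suc j = length xs" "i = 0" using assms by auto
    then show ?thesis using assms unfolding cycle_edges_def
      by (intro CollectI exI[of _ j]) (simp add: insert_commute)
  qed
qed

lemma near_chordless_cycle:
  assumes "is_cycle G xs" "\<not> has_chord G xs" "i < j" "j < length xs" "near G (xs ! i) (xs ! j)"
  shows "j = Suc i \<or> i = 0 \<and> j = length xs - 1"
proof -
  have d: "distinct xs" using assms(1) by (simp add: is_cycle_def)
  have "xs ! i \<noteq> xs ! j" using d assms by (simp add: nth_eq_iff_index_eq)
  then have "{xs ! i, xs ! j} \<in> edges G" using assms by (auto simp: near_def)
  then have "{xs ! i, xs ! j} \<in> cycle_edges xs" using assms by (auto simp: has_chord_def)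
  then show ?thesis using cycle_edges_nth[OF d] assms by blast
qed

lemma chordless_cycleI:
  assumes "simple_graph G" "3 \<le> length xs" "distinct xs" "set xs \<subseteq> verts G"
    and "\<And>i j. i < j \<Longrightarrow> j < length xs \<Longrightarrow>
      {xs ! i, xs ! j} \<in> edges G \<longleftrightarrow> j = Suc i \<or> i = 0 \<and> j = length xs - 1"
  shows "is_cycle G xs \<and> \<not> has_chord G xs"
proof
  have "{xs ! i, xs ! (Suc i mod length xs)} \<in> edges G" if "i < length xs" for i
  proof (cases "Suc i = length xs")
    case True
    then show ?thesis using assms(5)[of 0 i] assms(2) by (auto simp: insert_commute)
  next
    case False
    then show ?thesis using assms(5)[of i "Suc i"] that by auto
  qed
  then show "is_cycle G xs" using assms by (auto simp: is_cycle_def cycle_edges_def)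
  show "\<not> has_chord G xs"
  proof
    assume "has_chord G xs"
    then obtain e where e: "e \<in> edges G" "e \<subseteq> set xs" "e \<notin> cycle_edges xs"
      by (auto simp: has_chord_def)
    then obtain u v where uv: "e = {u, v}" "u \<noteq> v" using assms(1) unfolding simple_graph_def by metis
    then obtain i j where ij: "i < length xs" "j < length xs" "u = xs ! i" "v = xs ! j"
      using e(2) by (auto simp: in_set_conv_nth)
    consider "i < j" | "j < i" using uv ij by (metis linorder_neqE_nat)
    then show False
      using assms(5)[of i j] assms(5)[of j i] cycle_edges_nth[OF assms(3), of i j]
        cycle_edges_nth[OF assms(3), of j i] e uv ij
      by cases (auto simp: insert_commute)
  qed
qed

text \<open>A diagonal with near ends splits the walk into two shorter ones, recombined by
  \<open>fillable_subst\<close>. Without such a diagonal, a walk with at least four entries is a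
  chordless cycle, which \<open>hole\<close> excludes. The parameters \<open>n\<close> and
  \<open>X\<close> serve two uses: short walks in an \<open>r\<close>-chordal graph, and walks in a
  closed neighbourhood.\<close>

lemma closed_walk_fillable:
  assumes G: "simple_graph G"
    and hole: "\<And>xs. is_cycle G xs \<Longrightarrow> 4 \<le> length xs \<Longrightarrow> length xs \<le> n \<Longrightarrow> set xs \<subseteq> X \<Longrightarrow> has_chord G xs"
  shows "2 \<le> length f \<Longrightarrow> length f \<le> n \<Longrightarrow> set f \<subseteq> X \<Longrightarrow> successively (near G) f \<Longrightarrow>
    near G (hd f) (last f) \<Longrightarrow> fillable G f"
proof (induction f rule: length_induct)
  case (1 f)
  note p = "1.prems"
  have IH: "fillable G g" if "length g < length f" "2 \<le> length g" "set g \<subseteq> set f"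
     "successively (near G) g" "near G (hd g) (last g)" for g
    using "1.IH" that p by auto
  have ne: "f \<noteq> []" using p by auto
  have suc: "near G (f ! i) (f ! Suc i)" if "Suc i < length f" for i
    using p(4) that by (simp add: successively_conv_nth)
  have ends: "near G (f ! 0) (f ! (length f - 1))" using p(5) ne by (simp add: hd_conv_nth last_conv_nth)
  show ?case
  \<comment> \<open>The excluded pair of first and last index is the closing side, not a
    diagonal.\<close>
  proof (cases "\<exists>i j. Suc i < j \<and> j < length f \<and> near G (f ! i) (f ! j) \<and> \<not> (i = 0 \<and> j = length f - 1)")
    case True
    then obtain i j where ij: "Suc i < j" "j < length f" "near G (f ! i) (f ! j)"
      "\<not> (i = 0 \<and> j = length f - 1)" by blast
    obtain A B C where f: "f = A @ f ! i # B @ f ! j # C" "B \<noteq> []" "length A = i"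
      "length C = length f - Suc j"
      using nonconsecutive_split[OF ij(1,2)] by blast
    define u v where uv: "u = f ! i" "v = f ! j"
    have f': "f = A @ u # B @ v # C" using f(1) by (simp add: uv)
    have AC: "A \<noteq> [] \<or> C \<noteq> []" using f ij by auto
    have uvn: "near G u v" using ij uv by simp
    have "fillable G (u # B @ [v])"
      using p(4) f(2) AC uvn unfolding f'
      by (intro IH) (auto simp: f' successively_append_iff successively_Cons)
    moreover have "fillable G (A @ u # v # C)"
    proof (rule IH)
      show "length (A @ u # v # C) < length f" using f(2) by (simp add: f')
      show "successively (near G) (A @ u # v # C)"
        using p(4) uvn unfolding f' by (auto simp: successively_append_iff successively_Cons)
      have "hd (A @ u # v # C) = hd f" "last (A @ u # v # C) = last f" unfolding f' by (cases A; simp)+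
      then show "near G (hd (A @ u # v # C)) (last (A @ u # v # C))" using p by simp
    qed (auto simp: f')
    ultimately show ?thesis using fillable_subst f' by metis
  next
    case False
    then have F: "j = Suc i \<or> i = 0 \<and> j = length f - 1"
      if "i < j" "j < length f" "near G (f ! i) (f ! j)" for i j
      using that by (metis Suc_lessI)
    consider "length f = 2" | "length f = 3" | "4 \<le> length f" using p(1) by linarith
    then show ?thesis
    proof cases
      case 1
      then obtain a b where "f = [a, b]" by (auto simp: numeral_2_eq_2 length_Suc_conv)
      then show ?thesis using p by (auto intro: fillable.edge)
    next
      case 2
      then obtain a b c where "f = [a, b, c]" by (auto simp: numeral_3_eq_3 length_Suc_conv)
      then show ?thesis using p by (auto intro: fillable_triangle)
    next
      case 3
      have V: "f ! k \<in> verts G" if "k < length f" for k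
      proof (cases "Suc k < length f")
        case True
        then show ?thesis using suc by (auto simp: near_def)
      next
        case False
        then have "k = length f - 1" using that by simp
        then show ?thesis using ends by (simp add: near_def)
      qed
      \<comment> \<open>Equal entries are near, hence cyclically consecutive. A further neighbour of
        one of them is then near the other, which is a diagonal because there are at least four
        entries.\<close>
      have dis: "f ! i \<noteq> f ! j" if ij: "i < j" "j < length f" for i j
      proof
        assume eq: "f ! i = f ! j"
        have "near G (f ! i) (f ! j)" using eq V[of j] ij by (simp add: near_def)
        from F[OF ij this] show False
        proof
          assume j: "j = Suc i"
          show False
          proof (cases "Suc j < length f")
            case True
            then show ?thesis using suc[of j] F[of i "Suc j"] eq j 3 by auto
          next
            case False
            then have "i = Suc (i - 1)" "j = length f - 1" using j ij 3 by auto
            then have "near G (f ! (i - 1)) (f ! j)" using suc[of "i - 1"] eq ij by simp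
            then have "j = Suc (i - 1) \<or> i - 1 = 0" using F[of "i - 1" j] ij by linarith
            then show ?thesis using j 3 \<open>i = Suc (i - 1)\<close> \<open>j = length f - 1\<close> by linarith
          qed
        next
          assume ij0: "i = 0 \<and> j = length f - 1"
          then have "near G (f ! 0) (f ! (length f - 2))"
            using near_sym[OF suc[of "length f - 2"]] 3 eq by (simp add: Suc_diff_Suc numeral_2_eq_2)
          then show False using F[of 0 "length f - 2"] 3 by linarith
        qed
      qed
      have d: "distinct f" unfolding distinct_conv_nth using dis by (metis linorder_neqE_nat)
      have sv: "set f \<subseteq> verts G" using V by (auto simp: in_set_conv_nth)
      have "is_cycle G f \<and> \<not> has_chord G f"
      proof (rule chordless_cycleI[OF G _ d sv])
        show "3 \<le> length f" using 3 by simp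
        fix i j assume ij: "i < j" "j < length f"
        have "{f ! i, f ! j} \<in> edges G \<longleftrightarrow> near G (f ! i) (f ! j)"
          using dis[OF ij] sv ij by (auto simp: near_def)
        then show "{f ! i, f ! j} \<in> edges G \<longleftrightarrow> j = Suc i \<or> i = 0 \<and> j = length f - 1"
          using F[OF ij] suc[of i] ends ij by auto
      qed
      then show ?thesis using hole[of f] 3 p by auto
    qed
  qed
qed

text \<open>The triangle on the closing side needs an apex adjacent to both ends of that side;
  without chords this forces the cycle to have length three.\<close>

lemma chordless_cycle_not_fillable:
  assumes c: "is_cycle G xs" "\<not> has_chord G xs" "4 \<le> length xs"
  shows "\<not> fillable G xs"
proof
  assume "fillable G xs"
  then show False
  proof cases
    case (edge a b)
    then show ?thesis using c by simp
  next
    case (glue ys b zs)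
    then have ne: "ys \<noteq> []" "zs \<noteq> []" using fillable_length by fastforce+
    have n: "xs ! 0 = hd ys" "xs ! length ys = b" "xs ! (length xs - 1) = last zs"
      using glue(1) ne by (auto simp: nth_append hd_conv_nth last_conv_nth nth_Cons')
    have "near G (xs ! 0) (xs ! length ys)" "near G (xs ! length ys) (xs ! (length xs - 1))"
      using fillable_near_ends[OF glue(2)] fillable_near_ends[OF glue(3)] ne n by auto
    moreover have l: "0 < length ys" "length ys < length xs - 1" "length xs - 1 < length xs"
      using ne glue(1) c(3) by auto
    ultimately have "length ys = 1" "length xs - 1 = Suc (length ys)"
      using near_chordless_cycle[OF c(1,2), of 0 "length ys"]
        near_chordless_cycle[OF c(1,2), of "length ys" "length xs - 1"] by auto
    then show ?thesis using c(3) by simp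
  qed
qed

section \<open>Wheels and vertex deletion\<close>

lemma wheel_rim_edge:
  assumes "i < j" "j < n"
  shows "{i, j} \<in> edges (wheel n) \<longleftrightarrow> j = Suc i \<or> i = 0 \<and> j = n - 1"
proof -
  have "Suc k mod n < n" for k using assms by (intro mod_less_divisor) linarith
  then have "cycle_edges [0..<n] = {{i, Suc i mod n} | i. i < n}"
    unfolding cycle_edges_def by (intro Collect_cong ex_cong1) auto
  moreover have "{i, j} \<notin> {{i, n} | i. i < n}" using assms by (auto simp: doubleton_eq_iff)
  ultimately have "{i, j} \<in> edges (wheel n) \<longleftrightarrow> {i, j} \<in> cycle_edges [0..<n]"
    by (auto simp: wheel_def)
  then show ?thesis using cycle_edges_nth[of "[0..<n]" i j] assms by simp
qed

lemma wheel_spoke_edge: "i < n \<Longrightarrow> {i, n} \<in> edges (wheel n)"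
  by (auto simp: wheel_def)

text \<open>\<open>graph_iso\<close> also compares the degenerate pairs \<open>{u, u}\<close>, so
  loops have to be ruled out on the side of the wheel as well.\<close>

lemma wheel_no_loop:
  assumes "2 \<le> n" shows "{i} \<notin> edges (wheel n)"
proof -
  have "Suc k mod n \<noteq> k" if "k < n" for k
    using assms that by (cases "Suc k = n") auto
  then show ?thesis by (auto simp: wheel_def singleton_insert_inj_eq)
qed

text \<open>If \<open>y\<close> lay on the cycle, the vertex two places away would give a chord at
  \<open>y\<close>. Hence \<open>y\<close> is off the cycle, and a chordless cycle would be the rim
  of an induced wheel with hub \<open>y\<close>.\<close>

lemma wheel_free_chord:
  assumes G: "simple_graph G" and wf: "wheel_free G"
    and c: "is_cycle G xs" "4 \<le> length xs" and sub: "set xs \<subseteq> {v. near G v y}"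
  shows "has_chord G xs"
proof (rule ccontr)
  assume nc: "\<not> has_chord G xs"
  define n where "n = length xs"
  have d: "distinct xs" and V: "set xs \<subseteq> verts G" using c by (auto simp: is_cycle_def)
  have yV: "y \<in> verts G" using sub c(2) by (cases xs) (auto simp: near_def)
  have y: "y \<notin> set xs"
  proof
    assume "y \<in> set xs"
    then obtain i where i: "i < n" "y = xs ! i" by (auto simp: in_set_conv_nth n_def)
    show False
    proof (cases "i + 2 < n")
      case True
      then have "xs ! (i + 2) \<in> set xs" by (simp add: n_def)
      then have "near G (xs ! i) (xs ! (i + 2))" using sub i near_sym by fastforce
      then show False using near_chordless_cycle[OF c(1) nc, of i "i + 2"] True c(2) by (auto simp: n_def)
    next
      case False
      then have i2: "2 \<le> i" "i - 2 < i" using c(2) n_def by auto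
      then have "xs ! (i - 2) \<in> set xs" using i(1) by (simp add: n_def)
      then have "near G (xs ! (i - 2)) (xs ! i)" using sub i(2) by blast
      then show False
        using near_chordless_cycle[OF c(1) nc i2(2)] i i2 c(2) unfolding n_def by linarith
    qed
  qed
  let ?X = "insert y (set xs)" and ?f = "\<lambda>i. if i < n then xs ! i else y"
  have "graph_iso (wheel n) (induced G ?X) ?f"
    unfolding graph_iso_def
  proof (intro conjI ballI)
    have "inj_on ?f {..n}"
    proof (rule inj_onI)
      fix i j assume "i \<in> {..n}" "j \<in> {..n}" "?f i = ?f j"
      then show "i = j" using y d nth_mem[of i xs] nth_mem[of j xs]
        by (auto simp: n_def nth_eq_iff_index_eq split: if_splits)
    qed
    moreover have "?f ` {..n} = ?X"
    proof (intro equalityI subsetI)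
      fix x assume "x \<in> ?X"
      then consider "x = y" | i where "i < n" "x = xs ! i" by (auto simp: in_set_conv_nth n_def)
      then show "x \<in> ?f ` {..n}"
        by cases (auto intro: image_eqI[of _ _ n] image_eqI)
    qed (auto simp: n_def)
    ultimately show "bij_betw ?f (verts (wheel n)) (verts (induced G ?X))"
      using V yV by (auto simp: bij_betw_def wheel_def induced_def)
  next
    fix u v assume uv: "u \<in> verts (wheel n)" "v \<in> verts (wheel n)"
    have E: "{?f u, ?f v} \<in> edges (induced G ?X) \<longleftrightarrow> {?f u, ?f v} \<in> edges G"
      by (auto simp: induced_def n_def)
    have lt: "{u, v} \<in> edges (wheel n) \<longleftrightarrow> {?f u, ?f v} \<in> edges G" if uv: "u < v" "v \<le> n" for u v
    proof (cases "v < n")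
      case True
      have "{xs ! u, xs ! v} \<in> edges G \<longleftrightarrow> {xs ! u, xs ! v} \<in> cycle_edges xs"
        using c(1) nc uv True by (auto simp: is_cycle_def has_chord_def n_def)
      then show ?thesis
        using wheel_rim_edge[OF uv(1) True] cycle_edges_nth[OF d uv(1)] True uv by (auto simp: n_def)
    next
      case False
      then have v: "v = n" "u < n" using uv by auto
      then have "xs ! u \<in> set xs" by (simp add: n_def)
      then have "{xs ! u, y} \<in> edges G" using sub y unfolding near_def by blast
      then show ?thesis using wheel_spoke_edge[of u n] v by simp
    qed
    consider "u < v" | "v < u" | "u = v" by linarith
    then show "{u, v} \<in> edges (wheel n) \<longleftrightarrow> {?f u, ?f v} \<in> edges (induced G ?X)"
    proof cases
      case 1
      then show ?thesis using lt[of u v] uv E by (simp add: wheel_def)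
    next
      case 2
      then show ?thesis using lt[of v u] uv E by (simp add: wheel_def insert_commute)
    next
      case 3
      have "{x} \<notin> edges G" for x using G unfolding simple_graph_def by fastforce
      then show ?thesis using wheel_no_loop[of n u] c(2) 3 E by (simp add: n_def)
    qed
  qed
  moreover have "?X \<subseteq> verts G" using V yV by simp
  ultimately show False using wf c(2) unfolding wheel_free_def n_def by blast
qed

text \<open>The rim of an induced wheel is itself a chordless cycle of length at least four.\<close>

lemma chordal_imp_wheel_free:
  assumes G: "simple_graph G" and ch: "chordal G"
  shows "wheel_free G"
  unfolding wheel_free_def
proof
  assume "\<exists>n\<ge>4. \<exists>X\<subseteq>verts G. \<exists>f. graph_iso (wheel n) (induced G X) f"
  then obtain n X f where n: "4 \<le> n" and X: "X \<subseteq> verts G" and f: "graph_iso (wheel n) (induced G X) f"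
    by blast
  have b: "bij_betw f {..n} X"
    using f X by (simp add: graph_iso_def wheel_def induced_def Int_absorb1)
  have e: "{u, v} \<in> edges (wheel n) \<longleftrightarrow> {f u, f v} \<in> edges G" if "u \<le> n" "v \<le> n" for u v
    using f that bij_betwE[OF b] by (auto simp: graph_iso_def wheel_def induced_def)
  let ?xs = "map f [0..<n]"
  have "is_cycle G ?xs \<and> \<not> has_chord G ?xs"
  proof (rule chordless_cycleI[OF G])
    show "3 \<le> length ?xs" using n by simp
    show "distinct ?xs" using b by (auto simp: distinct_map bij_betw_def intro: inj_on_subset)
    show "set ?xs \<subseteq> verts G" using bij_betwE[OF b] X by auto
    fix i j assume "i < j" "j < length ?xs"
    then show "{?xs ! i, ?xs ! j} \<in> edges G \<longleftrightarrow> j = Suc i \<or> i = 0 \<and> j = length ?xs - 1"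
      using e[of i j] wheel_rim_edge[of i j n] by simp
  qed
  then show False using ch n by (auto simp: chordal_def)
qed

text \<open>The walk \<open>f\<close> consists of the ends other than \<open>y\<close> of the triangulation edges at \<open>y\<close>; the last
  clause glues the triangles cut off by \<open>f\<close> back on.\<close>

lemma fillable_fan:
  "fillable G (us @ [y]) \<Longrightarrow> \<exists>f. f \<noteq> [] \<and> hd f = hd us \<and> last f = last us \<and> successively (near G) f \<and>
     set f \<subseteq> {v. near G v y} \<and> (\<forall>ps qs. fillable G (ps @ f @ qs) \<longrightarrow> fillable G (ps @ us @ qs))"
proof (induction "us @ [y]" arbitrary: us rule: fillable.induct)
  case (edge a b)
  then show ?case by (intro exI[of _ "[a]"]) auto
next
  case (glue xs b ys)
  have ne: "xs \<noteq> []" "ys \<noteq> []"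
    using fillable_length[OF glue.hyps(1)] fillable_length[OF glue.hyps(3)] by auto
  then obtain ys' where ys: "ys = ys' @ [y]" and us: "us = xs @ b # ys'"
    using glue.hyps(6) by (cases ys rule: rev_cases) auto
  have "b # ys = (b # ys') @ [y]" by (simp add: ys)
  from glue.hyps(4)[OF this] obtain f where f: "f \<noteq> []" "hd f = b" "last f = last (b # ys')"
    "successively (near G) f" "set f \<subseteq> {v. near G v y}"
    and fill: "\<And>ps qs. fillable G (ps @ f @ qs) \<Longrightarrow> fillable G (ps @ (b # ys') @ qs)"
    by auto
  \<comment> \<open>The triangle on the closing side is \<open>a\<close>, \<open>b\<close>,
    \<open>y\<close>. So \<open>a\<close> precedes \<open>f\<close> among the ends of the edges at
    \<open>y\<close>, and \<open>xs @ [b]\<close> is the piece cut off by the side from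
    \<open>a\<close> to \<open>b\<close>.\<close>
  obtain a xs' where xs: "xs = a # xs'" using ne by (cases xs) auto
  have ab: "near G a b" using fillable_near_ends[OF glue.hyps(1)] by (simp add: xs)
  show ?case
  proof (intro exI[of _ "a # f"] conjI allI impI)
    show "successively (near G) (a # f)" using f ab by (cases f) auto
    show "set (a # f) \<subseteq> {v. near G v y}" using f glue.hyps(5) by (simp add: xs ys)
    fix ps qs assume "fillable G (ps @ (a # f) @ qs)"
    then have "fillable G (ps @ a # b # ys' @ qs)" using fill[of "ps @ [a]" qs] by simp
    from fillable_subst[OF this, of xs'] glue.hyps(1) show "fillable G (ps @ us @ qs)"
      by (simp add: xs us)
  qed (use f in \<open>auto simp: us xs\<close>)
qed

text \<open>By \<open>wheel_free_chord\<close> a closed neighbourhood contains no chordless cycle of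
  length at least four, so \<open>closed_walk_fillable\<close> applies with this neighbourhood as
  \<open>X\<close>.\<close>

lemma star_fillable:
  assumes "simple_graph G" "wheel_free G" "2 \<le> length f" "set f \<subseteq> {v. near G v y}"
    "successively (near G) f" "near G (hd f) (last f)"
  shows "fillable G f"
  using closed_walk_fillable[where n = "length f" and X = "{v. near G v y}", OF assms(1)]
    wheel_free_chord[OF assms(1,2)] assms by blast

lemma fillable_delete_last:
  assumes "simple_graph G" "wheel_free G" "fillable G (us @ [y])" "near G (hd us) (last us)"
    "hd us \<noteq> last us"
  shows "fillable G us"
proof -
  obtain f where f: "f \<noteq> []" "hd f = hd us" "last f = last us" "successively (near G) f"
    "set f \<subseteq> {v. near G v y}"
    and fill: "\<And>ps qs. fillable G (ps @ f @ qs) \<Longrightarrow> fillable G (ps @ us @ qs)"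
    using fillable_fan[OF assms(3)] by blast
  \<comment> \<open>Since the ends of \<open>us\<close> differ, \<open>f\<close> is not a single
    vertex, which would be too short for a polygon.\<close>
  have "2 \<le> length f" using f(1-3) assms(5) by (cases f; cases "tl f") auto
  then have "fillable G ([] @ f @ [])" using star_fillable[OF assms(1,2)] f assms(4) by simp
  from fill[OF this] show ?thesis by simp
qed

text \<open>The induction descends to the piece with \<open>y\<close> in its interior until
  \<open>y\<close> is the apex of the triangle on the closing side. There the fans at
  \<open>y\<close> on both sides have outer walks \<open>f\<close> and \<open>rev g\<close>; linked
  by the pair \<open>x\<close>, \<open>z\<close> and closed by the closing side, they form a closed
  walk near \<open>y\<close>, which \<open>star_fillable\<close> fills.\<close>

lemma fillable_delete:
  assumes G: "simple_graph G" "wheel_free G" and xz: "near G x z"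
  shows "fillable G (ps @ x # y # z # qs) \<Longrightarrow> fillable G (ps @ x # z # qs)"
proof (induction "ps @ x # y # z # qs" arbitrary: ps qs rule: fillable.induct)
  case (edge a b)
  then show ?case by (auto simp: append_eq_Cons_conv Cons_eq_append_conv)
next
  case (glue xs b ys)
  have ne: "xs \<noteq> []" "ys \<noteq> []"
    using fillable_length[OF glue.hyps(1)] fillable_length[OF glue.hyps(3)] by auto
  show ?case using glue.hyps(6)
  proof (cases rule: append_triple_cases)
    case (1 q)
    have "hd (ps @ x # z # q) = hd xs" "last (ps @ x # z # q) = b"
      using arg_cong[OF 1(1), of hd] arg_cong[OF 1(1), of last] ne by (auto simp: hd_append split: if_splits)
    then have "fillable G ((ps @ x # z # q) @ tl (b # ys))"
      using glue.hyps(2)[OF 1(1)] glue.hyps(3,5) ne by (intro fillable_join) simp_all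
    then show ?thesis using 1(2) by simp
  next
    case (2 p)
    let ?B = "p @ x # z # qs"
    have h: "hd ?B = b" "last ?B = last ys" "?B \<noteq> []"
      using arg_cong[OF 2(2), of hd] arg_cong[OF 2(2), of last] ne by (auto simp: hd_append split: if_splits)
    then have "fillable G ((xs @ [b]) @ tl ?B)"
      using glue.hyps(4)[OF 2(2)] glue.hyps(1,5) ne by (intro fillable_join) simp_all
    moreover have "b # tl ?B = ?B" using h by (metis list.collapse)
    ultimately show ?thesis using 2(1) by (metis append.assoc append_Cons append_Nil)
  next
    case 3
    obtain f where f: "f \<noteq> []" "hd f = hd xs" "last f = x" "successively (near G) f"
      "set f \<subseteq> {v. near G v y}"
      and ff: "\<And>ps qs. fillable G (ps @ f @ qs) \<Longrightarrow> fillable G (ps @ xs @ qs)"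
      using fillable_fan[OF glue.hyps(1)] 3 by auto
    \<comment> \<open>\<open>fillable_fan\<close> expects \<open>y\<close> as the last vertex, so
      the second piece is mirrored here and mirrored back at the end.\<close>
    have "fillable G (rev ys @ [y])" using fillable_rev[OF glue.hyps(3)] 3 by simp
    then obtain g where g: "g \<noteq> []" "hd g = last ys" "last g = z" "successively (near G) g"
      "set g \<subseteq> {v. near G v y}"
      and gg: "\<And>ps qs. fillable G (ps @ g @ qs) \<Longrightarrow> fillable G (ps @ rev ys @ qs)"
      using fillable_fan[of G "rev ys" y] ne 3 by (auto simp: hd_rev last_rev)
    have "fillable G (f @ rev g)"
    proof (rule star_fillable[OF G])
      show "2 \<le> length (f @ rev g)" using f(1) g(1) by (cases f; cases g) auto
      have "successively (\<lambda>x y. near G y x) g" using g(4) near_sym by (rule successively_mono)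
      then show "successively (near G) (f @ rev g)"
        using f g xz by (simp add: successively_append_iff hd_rev)
      show "near G (hd (f @ rev g)) (last (f @ rev g))"
        using f g glue.hyps(5) by (simp add: last_rev)
    qed (use f g in auto)
    then have "fillable G (xs @ rev g)" using ff[of "[]" "rev g"] by simp
    then have "fillable G ([] @ g @ rev xs)" using fillable_rev[of G "xs @ rev g"] by simp
    from fillable_rev[OF gg[OF this]] show ?thesis using 3 by simp
  qed
qed

section \<open>Removing detours, splicing loops and cancelling backtracks in polygons\<close>

lemma fillable_unsubst:
  assumes G: "simple_graph G" "wheel_free G"
  shows "fillable G (x # m @ [z]) \<Longrightarrow> fillable G (ps @ x # m @ z # qs) \<Longrightarrow> fillable G (ps @ x # z # qs)"
proof (induction "x # m @ [z]" arbitrary: x m z ps qs rule: fillable.induct)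
  case (edge a b)
  then show ?case by simp
next
  case (glue xs b ys)
  have ne: "xs \<noteq> []" "ys \<noteq> []"
    using fillable_length[OF glue.hyps(1)] fillable_length[OF glue.hyps(3)] by auto
  then obtain xs' where xs: "xs = x # xs'" using glue.hyps(6) by (cases xs) auto
  obtain ys' where ys: "ys = ys' @ [z]" using glue.hyps(6) ne(2)
    by (metis append_butlast_last_id last.simps last_appendR list.discI snoc_eq_iff_butlast append_Cons)
  have m: "m = xs' @ b # ys'" using glue.hyps(6) by (simp add: xs ys)
  \<comment> \<open>Both pieces of the detour are shrunk to their closing sides, leaving
    \<open>x\<close>, \<open>b\<close>, \<open>z\<close>; then \<open>b\<close> can be deleted
    because \<open>x\<close> and \<open>z\<close> are near.\<close>
  have "fillable G (ps @ x # xs' @ b # (ys' @ z # qs))" using glue.prems m by simp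
  then have "fillable G (ps @ x # b # (ys' @ z # qs))" using glue.hyps(2) xs by (metis append_Cons)
  then have "fillable G ((ps @ [x]) @ b # ys' @ z # qs)" by simp
  then have "fillable G ((ps @ [x]) @ b # z # qs)" using glue.hyps(4) ys by blast
  then show ?case using fillable_delete[OF G, of x z ps b qs] glue.hyps(5) xs ys by simp
qed

lemma fillable_stutter:
  assumes "fillable G (ps @ x # qs)"
  shows "fillable G (ps @ x # x # qs)"
proof -
  have s: "successively (near G) (ps @ x # qs)" by (rule fillable_successively[OF assms])
  consider z qs' where "qs = z # qs'" | y ps' where "ps = ps' @ [y]" "qs = []"
    using fillable_length[OF assms] by (cases qs; cases ps rule: rev_cases) auto
  then show ?thesis
  proof cases
    case 1
    then have "near G x z" using s by (auto simp: successively_append_iff)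
    then have "fillable G (x # [x] @ [z])" using fillable_triangle[of G x x z] near_refl(1)[of G x z] by simp
    from fillable_subst[OF _ this, of ps qs'] show ?thesis using assms 1 by simp
  next
    case 2
    then have "near G y x" using s by (auto simp: successively_append_iff)
    then have "fillable G (y # [x] @ [x])" using fillable_triangle[of G y x x] near_refl(2)[of G y x] by simp
    from fillable_subst[OF _ this, of ps' qs] show ?thesis using assms 2 by simp
  qed
qed

text \<open>One copy is deleted as a vertex between its twin and an adjacent entry supplied by
  \<open>ne\<close>; the list with the single entry \<open>x\<close> would not be fillable.\<close>

lemma fillable_unstutter:
  assumes G: "simple_graph G" "wheel_free G" and f: "fillable G (ps @ x # x # qs)" and ne: "ps \<noteq> [] \<or> qs \<noteq> []"
  shows "fillable G (ps @ x # qs)"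
proof -
  have s: "successively (near G) (ps @ x # x # qs)" by (rule fillable_successively[OF f])
  consider z qs' where "qs = z # qs'" | y ps' where "ps = ps' @ [y]" "qs = []"
    using ne by (cases qs; cases ps rule: rev_cases) auto
  then show ?thesis
  proof cases
    case 1
    then have "near G x z" using s by (auto simp: successively_append_iff)
    from fillable_delete[OF G this, of ps x qs'] show ?thesis using f 1 by simp
  next
    case 2
    then have "near G y x" using s by (auto simp: successively_append_iff)
    from fillable_delete[OF G this, of ps' x qs] show ?thesis using f 2 by simp
  qed
qed

text \<open>Doubling the base vertex creates a degenerate side, to which the loop is attached or
  from which it is removed. This makes fillability invariant under elementary homotopies.\<close>

lemma fillable_splice:
  assumes G: "simple_graph G" "wheel_free G" and c: "fillable G c" "hd c = last c" and ne: "ps \<noteq> [] \<or> qs \<noteq> []"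
  shows "fillable G (ps @ c @ qs) \<longleftrightarrow> fillable G (ps @ hd c # qs)"
proof -
  obtain x m where cm: "c = x # m @ [x]"
    using fillable_length[OF c(1)] c(2) by (cases c; cases "tl c" rule: rev_cases) auto
  show ?thesis
  proof
    assume "fillable G (ps @ c @ qs)"
    then have "fillable G (ps @ x # x # qs)" using fillable_unsubst[OF G, of x m x ps qs] c(1) cm by simp
    then show "fillable G (ps @ hd c # qs)" using fillable_unstutter[OF G _ ne] cm by simp
  next
    assume "fillable G (ps @ hd c # qs)"
    then have "fillable G (ps @ x # x # qs)" using fillable_stutter cm by simp
    then show "fillable G (ps @ c @ qs)" using fillable_subst[of G ps x x qs m] c(1) cm by simp
  qed
qed

text \<open>Supplies the starting polygon of the lifted homotopy. It grows in the middle: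
  \<open>a\<close> is inserted between the two copies of \<open>b\<close> and then doubled.\<close>

lemma fillable_rev_append:
  assumes "walk G w" shows "fillable G (rev w @ w)"
  using assms
proof (induction w)
  case Nil
  then show ?case by (simp add: walk_def)
next
  case (Cons a w)
  show ?case
  proof (cases w)
    case Nil
    then show ?thesis using Cons.prems by (auto simp: walk_def near_def intro: fillable.edge)
  next
    case (Cons b w')
    then have ab: "near G b a" and "walk G w" using Cons.prems by (auto simp: walk_def near_def insert_commute)
    then have f: "fillable G (rev w' @ b # b # w')" using Cons.IH Cons by simp
    have "fillable G (b # [a] @ [b])" using fillable_triangle[of G b a b] ab near_sym[OF ab] near_refl(1)[OF ab] by simp
    from fillable_subst[OF f this] have "fillable G ((rev w' @ [b]) @ a # b # w')" by simp
    from fillable_stutter[OF this] show ?thesis using Cons by simp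
  qed
qed

text \<open>Reverses the growth in \<open>fillable_rev_append\<close>: the doubled first vertex of
  the walk is merged and then deleted, its two neighbours being equal.\<close>

lemma fillable_cancel_rev:
  assumes G: "simple_graph G" "wheel_free G" and w: "walk G w" and ys: "ys \<noteq> []"
  shows "fillable G (rev w @ w @ ys) \<Longrightarrow> fillable G (last w # ys)"
  using w
proof (induction w)
  case Nil
  then show ?case by (simp add: walk_def)
next
  case (Cons a w)
  show ?case
  proof (cases w)
    case Nil
    then show ?thesis using fillable_unstutter[OF G, of "[]" a ys] Cons.prems ys by simp
  next
    case (Cons b w')
    then have ab: "near G b a" and w: "walk G w" using Cons.prems by (auto simp: walk_def near_def insert_commute)
    have "fillable G ((rev w' @ [b]) @ a # a # b # w' @ ys)" using Cons.prems Cons by simp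
    from fillable_unstutter[OF G this] have "fillable G (rev w' @ b # a # b # w' @ ys)" by simp
    from fillable_delete[OF G _ this] have "fillable G (rev w @ w @ ys)" using near_refl(1)[OF ab] Cons by simp
    then show ?thesis using Cons.IH w Cons by simp
  qed
qed

section \<open>Walks, distances and coverings\<close>

lemma walk_append_iff:
  "ys \<noteq> [] \<Longrightarrow> zs \<noteq> [] \<Longrightarrow> walk G (ys @ zs) \<longleftrightarrow> walk G ys \<and> walk G zs \<and> {last ys, hd zs} \<in> edges G"
  by (auto simp: walk_def successively_append_iff)

lemma walk_snoc:
  assumes "simple_graph G" "ys \<noteq> []"
  shows "walk G (ys @ [v]) \<longleftrightarrow> walk G ys \<and> {last ys, v} \<in> edges G"
proof -
  have "v \<in> verts G" if "{last ys, v} \<in> edges G"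
    using simple_graph_edge_subset[OF assms(1) that] by simp
  then show ?thesis using walk_append_iff[OF assms(2), of "[v]" G] by (auto simp: walk_def)
qed

lemma walk_rev: "walk G (rev w) \<longleftrightarrow> walk G w"
  by (simp add: walk_def insert_commute)

lemma walks_between_rev: "xs \<in> walks_between G u v \<Longrightarrow> rev xs \<in> walks_between G v u"
  using walk_rev[of G xs] by (auto simp: walks_between_def hd_rev last_rev)

lemma walks_between_join:
  assumes "xs \<in> walks_between G u v" "ys \<in> walks_between G v w"
  shows "xs @ tl ys \<in> walks_between G u w"
proof (cases "tl ys = []")
  case True
  then have "v = w" using assms(2) by (cases ys) (auto simp: walks_between_def walk_def)
  then show ?thesis using assms(1) True by simp
next
  case False
  then obtain z zs where ys: "ys = v # z # zs"
    using assms(2) by (cases ys; cases "tl ys") (auto simp: walks_between_def walk_def)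
  then have "walk G (xs @ z # zs)"
    using assms by (subst walk_append_iff) (auto simp: walks_between_def walk_def)
  then show ?thesis using assms ys by (auto simp: walks_between_def walk_def)
qed

lemma gdist_le_iff: "gdist G u v \<le> enat k \<longleftrightarrow> (\<exists>xs\<in>walks_between G u v. length xs \<le> Suc k)"
proof -
  \<comment> \<open>A strict bound on an infimum is witnessed by a walk, hence the passage to
    \<open>Suc k\<close>.\<close>
  have "gdist G u v \<le> enat k \<longleftrightarrow> gdist G u v < enat (Suc k)" by (cases "gdist G u v") auto
  also have "\<dots> \<longleftrightarrow> (\<exists>xs\<in>walks_between G u v. enat (length xs - 1) < enat (Suc k))"
    unfolding gdist_def by (simp add: INF_less_iff)
  also have "\<dots> \<longleftrightarrow> (\<exists>xs\<in>walks_between G u v. length xs \<le> Suc k)"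
    by (intro bex_cong) auto
  finally show ?thesis .
qed

lemma walk_segment_gdist:
  assumes "walk G ys" "i \<le> j" "j < length ys"
  shows "gdist G (ys ! i) (ys ! j) \<le> enat (j - i)" "gdist G (ys ! j) (ys ! i) \<le> enat (j - i)"
proof -
  let ?s = "drop i (take (Suc j) ys)"
  have "take (Suc j) ys = take i ys @ ?s"
    using append_take_drop_id[of i "take (Suc j) ys"] assms(2) by (simp add: min_def)
  then have "ys = take i ys @ ?s @ drop (Suc j) ys"
    using append_take_drop_id[of "Suc j" ys] by (metis append.assoc)
  moreover have "successively (\<lambda>x y. {x, y} \<in> edges G) ys" using assms(1) by (simp add: walk_def)
  ultimately have "successively (\<lambda>x y. {x, y} \<in> edges G) ?s"
    using successively_append_iff by metis
  moreover have "set ?s \<subseteq> verts G" using assms(1) by (auto simp: walk_def dest: in_set_dropD in_set_takeD)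
  moreover have "?s \<noteq> []" using assms by auto
  moreover have "hd ?s = ys ! i" "last ?s = ys ! j" using assms by (auto simp: hd_drop_conv_nth last_conv_nth)
  ultimately have s: "?s \<in> walks_between G (ys ! i) (ys ! j)" by (simp add: walks_between_def walk_def)
  have l: "length ?s \<le> Suc (j - i)" using assms by auto
  show "gdist G (ys ! i) (ys ! j) \<le> enat (j - i)" unfolding gdist_le_iff using s l by blast
  show "gdist G (ys ! j) (ys ! i) \<le> enat (j - i)"
    unfolding gdist_le_iff using walks_between_rev[OF s] l by (intro bexI[of _ "rev ?s"]) auto
qed

section \<open>Half-balls, lifting of walks, and short closed walks\<close>

lemma double_le_enat_iff: "2 * x \<le> enat r \<longleftrightarrow> (\<exists>k. x = enat k \<and> 2 * k \<le> r)"
  by (cases x) (auto simp: numeral_eq_enat)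

lemma half_ball_edge_iff:
  assumes "simple_graph G"
  shows "{x, y} \<in> edges (half_ball G v r) \<longleftrightarrow> {x, y} \<in> edges G \<and>
    (\<exists>k l. gdist G v x = enat k \<and> gdist G v y = enat l \<and> k + l < r)"
\<comment> \<open>For \<open>x = y\<close> the sum in \<open>half_ball\<close> has only one term;
  simplicity rules this pair out as an edge.\<close>
proof (cases "x = y")
  case True
  have "{y} \<notin> edges G" using assms unfolding simple_graph_def by fastforce
  then show ?thesis using True by (simp add: half_ball_def)
next
  case False
  then have "(\<Sum>u\<in>{x, y}. gdist G v u) = gdist G v x + gdist G v y" by simp
  then show ?thesis
    unfolding half_ball_def by (cases "gdist G v x"; cases "gdist G v y") auto
qed

lemma covering_edge_inj:
  assumes "covering H G p" "{x, a} \<in> edges H" "{x, b} \<in> edges H" "p a = p b"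
  shows "a = b"
proof -
  have "x \<in> verts H" using assms simple_graph_edge_subset by (fastforce simp: covering_def)
  then have "inj_on (image p) (incident H x)" using assms(1) by (auto simp: covering_def bij_betw_def)
  moreover have "{x, a} \<in> incident H x" "{x, b} \<in> incident H x" "p ` {x, a} = p ` {x, b}"
    using assms by (auto simp: incident_def)
  ultimately have "{x, a} = {x, b}" by (meson inj_onD)
  then show ?thesis by (auto simp: doubleton_eq_iff)
qed

lemma covering_edge_lift:
  assumes c: "covering H G p" and x: "x \<in> verts H" and e: "{p x, b} \<in> edges G"
  shows "\<exists>a. {x, a} \<in> edges H \<and> p a = b"
proof -
  have H: "simple_graph H" and G: "simple_graph G" using c by (auto simp: covering_def)
  have "{p x, b} \<in> incident G (p x)" using e by (simp add: incident_def)
  moreover have "image p ` incident H x = incident G (p x)" using c x by (simp add: covering_def bij_betw_def)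
  ultimately obtain d where "d \<in> incident H x" "p ` d = {p x, b}" by (metis imageE)
  then have d: "d \<in> edges H" "x \<in> d" "p ` d = {p x, b}" by (simp_all add: incident_def)
  then obtain u v where "d = {u, v}" "u \<noteq> v" using H unfolding simple_graph_def by metis
  then obtain a where a: "d = {x, a}" using d(2) by (metis insertE insert_commute singletonD)
  have "p x \<noteq> b" using G e unfolding simple_graph_def by fastforce
  moreover have "{p x, p a} = {p x, b}" using d(3) a by simp
  ultimately have "p a = b" by (metis doubleton_eq_iff)
  then show ?thesis using d a by blast
qed

lemma covering_walk_lift:
  assumes c: "covering H G p"
  shows "walk G ws \<Longrightarrow> x \<in> verts H \<Longrightarrow> p x = hd ws \<Longrightarrow> \<exists>xs. walk H xs \<and> hd xs = x \<and> map p xs = ws"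
proof (induction ws arbitrary: x)
  case Nil
  then show ?case by (simp add: walk_def)
next
  case (Cons a ws)
  show ?case
  proof (cases ws)
    case Nil
    then show ?thesis using Cons.prems by (intro exI[of _ "[x]"]) (auto simp: walk_def)
  next
    case (Cons b ws')
    then have w: "walk G ws" and e: "{p x, b} \<in> edges G" using Cons.prems by (auto simp: walk_def)
    obtain y where y: "{x, y} \<in> edges H" "p y = b" using covering_edge_lift[OF c Cons.prems(2) e] by blast
    have "simple_graph H" using c by (simp add: covering_def)
    then have yV: "y \<in> verts H" using simple_graph_edge_subset[OF _ y(1)] by simp
    have "p y = hd ws" using y(2) Cons by simp
    from Cons.IH[OF w yV this] obtain xs where xs: "walk H xs" "hd xs = y" "map p xs = ws" by blast
    then have "walk H (x # xs)" using y Cons.prems(2) by (cases xs) (auto simp: walk_def)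
    then show ?thesis using xs Cons.prems by (intro exI[of _ "x # xs"]) auto
  qed
qed

text \<open>Both ends project into the half-ball around the image of the middle vertex
  \<open>z\<close>. With an even number of edges, injectivity on the ball at \<open>z\<close>
  identifies the ends. With an odd number, the ball isomorphism yields an edge from the penultimate
  vertex to the first one; it has the same image as the last edge, so local injectivity identifies
  the ends.\<close>

lemma short_walk_closed:
  assumes b: "ball_preserving_covering r H G p" and ys: "walk H ys" "length ys \<le> Suc r" "p (hd ys) = p (last ys)"
  shows "hd ys = last ys"
proof -
  have c: "covering H G p" using b by (simp add: ball_preserving_covering_def)
  then have H: "simple_graph H" and G: "simple_graph G" and hom: "graph_hom H G p" by (auto simp: covering_def)
  \<comment> \<open>\<open>k\<close> counts edges. For odd \<open>k\<close> the midpoint is rounded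
    down, so the penultimate vertex has index \<open>2 * m\<close> and is at distance at most
    \<open>m\<close> from \<open>z\<close>.\<close>
  define k m z where "k = length ys - 1" and "m = k div 2" and "z = ys ! m"
  have ne: "ys \<noteq> []" using ys by (simp add: walk_def)
  then have ends: "hd ys = ys ! 0" "last ys = ys ! k" "k < length ys" "k \<le> r"
    using ys by (auto simp: k_def hd_conv_nth last_conv_nth)
  have V: "ys ! i \<in> verts H" if "i < length ys" for i using ys(1) that by (auto simp: walk_def)
  have mk: "m \<le> k" "m < length ys" using ends unfolding m_def by auto
  have iso: "graph_iso (half_ball H z r) (half_ball G (p z) r) p"
    using b V[OF mk(2)] by (simp add: ball_preserving_covering_def z_def)
  have ball: "y \<in> verts (half_ball H z r)" if y: "y \<in> verts H" "gdist H z y \<le> enat l" "2 * l \<le> r" for y l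
  proof -
    obtain l' where "gdist H z y = enat l'" "l' \<le> l" using y(2) by (cases "gdist H z y") auto
    then show ?thesis using y by (auto simp: half_ball_def double_le_enat_iff)
  qed
  have d0: "gdist H z (ys ! 0) \<le> enat m" using walk_segment_gdist(2)[OF ys(1), of 0 m] mk by (simp add: z_def)
  have b0: "ys ! 0 \<in> verts (half_ball H z r)" using V[of 0] d0 ends ne by (intro ball[of _ m]) (auto simp: m_def)
  show ?thesis
  proof (cases "even k")
    case True
    then have km: "k - m = m" "2 * m \<le> r" using ends by (auto simp: m_def)
    have "gdist H z (ys ! k) \<le> enat m"
      using walk_segment_gdist(1)[OF ys(1) mk(1)] ends km by (simp add: z_def)
    then have "ys ! k \<in> verts (half_ball H z r)" using V ends km by (intro ball) auto
    moreover have "inj_on p (verts (half_ball H z r))" using iso by (simp add: graph_iso_def bij_betw_def)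
    ultimately show ?thesis using b0 ys(3) ends by (metis inj_onD)
  next
    case False
    then have km: "k = Suc (2 * m)" "2 * m < r" using ends unfolding m_def by presburger+
    let ?y = "ys ! (2 * m)"
    have dy: "gdist H z ?y \<le> enat m"
      using walk_segment_gdist(1)[OF ys(1), of m "2 * m"] ends km by (simp add: z_def)
    have y: "?y \<in> verts (half_ball H z r)" using V ends km dy by (intro ball) auto
    have e: "{?y, ys ! k} \<in> edges H" using ys(1) ends km by (simp add: walk_def successively_conv_nth)
    have "p ` {?y, ys ! k} \<in> edges G" using hom e unfolding graph_hom_def by blast
    then have e': "{p ?y, p (ys ! 0)} \<in> edges G" using ys(3) ends by simp
    have "gdist G (p z) (p ?y) \<le> enat m" "gdist G (p z) (p (ys ! 0)) \<le> enat m"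
      using gdist_hom_le[OF hom] dy d0 order_trans by blast+
    then obtain i j where "gdist G (p z) (p ?y) = enat i" "gdist G (p z) (p (ys ! 0)) = enat j" "i \<le> m" "j \<le> m"
      by (cases "gdist G (p z) (p ?y)"; cases "gdist G (p z) (p (ys ! 0))") auto
    then have "{p ?y, p (ys ! 0)} \<in> edges (half_ball G (p z) r)"
      using e' km by (auto simp: half_ball_edge_iff[OF G])
    then have "{?y, ys ! 0} \<in> edges (half_ball H z r)" using iso y b0 unfolding graph_iso_def by blast
    then have "{?y, ys ! 0} \<in> edges H" by (simp add: half_ball_def)
    from covering_edge_inj[OF c this e] show ?thesis using ys(3) ends by simp
  qed
qed

section \<open>The covering by homotopy classes of walks\<close>

text \<open>A loop with \<open>k\<close> edges is listed with \<open>Suc k\<close> entries, so the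
  bound admits at most \<open>r\<close> edges.\<close>

definition short_loop :: "nat \<Rightarrow> 'v graph \<Rightarrow> 'v list \<Rightarrow> bool" where
  "short_loop r G c \<longleftrightarrow> walk G c \<and> hd c = last c \<and> length c \<le> Suc r"

text \<open>The elementary homotopy with fixed ends. For \<open>r\<close> at least 2 it includes
  backtracking, since an edge traversed forth and back is a short loop.\<close>

definition insert_loop :: "nat \<Rightarrow> 'v graph \<Rightarrow> 'v list \<Rightarrow> 'v list \<Rightarrow> bool" where
  "insert_loop r G w w' \<longleftrightarrow>
     (\<exists>us c vs. short_loop r G c \<and> w = us @ hd c # vs \<and> w' = us @ c @ vs)"

abbreviation homotopic :: "nat \<Rightarrow> 'v graph \<Rightarrow> 'v list \<Rightarrow> 'v list \<Rightarrow> bool" where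
  "homotopic r G \<equiv> equivclp (insert_loop r G)"

lemma walk_insert_loop:
  assumes "walk G c" "hd c = last c"
  shows "walk G (us @ c @ vs) \<longleftrightarrow> walk G (us @ hd c # vs)"
proof -
  have ne: "c \<noteq> []" using assms(1) by (simp add: walk_def)
  have x: "walk G [hd c]" using assms(1) ne by (auto simp: walk_def)
  have r: "walk G (c @ vs) \<longleftrightarrow> walk G (hd c # vs)"
  proof (cases "vs = []")
    case False
    then show ?thesis
      using walk_append_iff[OF ne False, of G] walk_append_iff[of "[hd c]" vs G] assms x by simp
  qed (use assms x in simp)
  show ?thesis
  proof (cases "us = []")
    case False
    then show ?thesis
      using walk_append_iff[OF False, of "c @ vs" G] walk_append_iff[OF False, of "hd c # vs" G] ne r by simp
  qed (use r in simp)
qed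

lemma insert_loop_invariants:
  assumes "insert_loop r G w w'"
  shows "walk G w \<longleftrightarrow> walk G w'" "hd w = hd w'" "last w = last w'"
proof -
  obtain us c vs where c: "walk G c" "hd c = last c" and w: "w = us @ hd c # vs" "w' = us @ c @ vs"
    using assms by (auto simp: insert_loop_def short_loop_def)
  have "c \<noteq> []" using c by (simp add: walk_def)
  then show "walk G w \<longleftrightarrow> walk G w'" "hd w = hd w'" "last w = last w'"
    using walk_insert_loop[OF c] c(2) unfolding w by (auto simp: hd_append)
qed

lemma homotopic_invariants:
  "homotopic r G w w' \<Longrightarrow> (walk G w \<longleftrightarrow> walk G w') \<and> hd w = hd w' \<and> last w = last w'"
proof (induction rule: equivclp_induct)
  case (step u v)
  from step.hyps(2) show ?case
    using step.IH insert_loop_invariants[of r G u v] insert_loop_invariants[of r G v u] by metis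
qed simp

lemma insert_loopI: "short_loop r G c \<Longrightarrow> insert_loop r G (us @ hd c # vs) (us @ c @ vs)"
  unfolding insert_loop_def by blast

lemma homotopic_append: "homotopic r G w w' \<Longrightarrow> homotopic r G (w @ z) (w' @ z)"
proof (induction rule: equivclp_induct)
  case (step u v)
  have "insert_loop r G (a @ z) (b @ z)" if ab: "insert_loop r G a b" for a b
  proof -
    obtain us c vs where "short_loop r G c" "a = us @ hd c # vs" "b = us @ c @ vs"
      using ab unfolding insert_loop_def by blast
    then show ?thesis using insert_loopI[of r G c us "vs @ z"] by simp
  qed
  then show ?case using step equivclp_into_equivclp by metis
qed simp

lemma homotopic_backtrack:
  assumes "simple_graph G" "2 \<le> r" "w \<noteq> []" "{last w, v} \<in> edges G"
  shows "homotopic r G (w @ [v, last w]) w"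
proof -
  obtain u x where w: "w = u @ [x]" using assms(3) by (metis rev_exhaust)
  have "walk G [x, v, x]"
    using assms(4) simple_graph_edge_subset[OF assms(1,4)] w by (auto simp: walk_def insert_commute)
  then have "short_loop r G [x, v, x]" using assms(2) by (simp add: short_loop_def)
  from insert_loopI[OF this, of u "[]"] show ?thesis using w by auto
qed

text \<open>Edges are taken from the end of \<open>zs\<close> and appended, reversed, to
  \<open>ys\<close>, which keeps the total length; the resulting backtrack cancels. Once
  \<open>zs\<close> is used up, \<open>ys\<close> leads back to the end of \<open>w\<close> and
  forms a single short loop.\<close>

lemma homotopic_short:
  assumes G: "simple_graph G" "2 \<le> r" and w: "w \<noteq> []"
  shows "walk G (w @ ys) \<Longrightarrow> walk G (w @ zs) \<Longrightarrow> last (w @ ys) = last (w @ zs) \<Longrightarrow>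
    length ys + length zs \<le> r \<Longrightarrow> homotopic r G (w @ ys) (w @ zs)"
proof (induction zs arbitrary: ys rule: rev_induct)
  case Nil
  obtain u x where ux: "w = u @ [x]" using w by (metis rev_exhaust)
  have "walk G (x # ys)"
    using Nil(1) walk_append_iff[of u "x # ys" G] by (cases "u = []") (simp_all add: ux)
  then have "short_loop r G (x # ys)" using Nil(3,4) by (simp add: short_loop_def ux)
  from insert_loopI[OF this, of u "[]"] show ?case using ux by auto
next
  case (snoc v zs)
  let ?u = "last (w @ zs)"
  have z: "walk G (w @ zs)" "{?u, v} \<in> edges G" using snoc.prems(2) walk_snoc[OF G(1), of "w @ zs" v] w by auto
  have v: "last (w @ ys) = v" using snoc.prems(3) by simp
  have vu: "{last (w @ ys), ?u} \<in> edges G" using z(2) v by (simp add: insert_commute)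
  then have "walk G (w @ ys @ [?u])" using walk_snoc[OF G(1), of "w @ ys" ?u] w snoc.prems(1) by simp
  then have "homotopic r G (w @ ys @ [?u]) (w @ zs)" using snoc.IH[of "ys @ [?u]"] z snoc.prems(4) by simp
  from homotopic_append[OF this, of "[v]"] have "homotopic r G ((w @ ys) @ [?u, v]) (w @ zs @ [v])" by simp
  moreover have "homotopic r G ((w @ ys) @ [?u, v]) (w @ ys)"
    using homotopic_backtrack[OF G, of "w @ ys" ?u] vu v w by simp
  ultimately show ?case using equivclp_sym equivclp_trans by metis
qed

locale walk_cover =
  fixes G :: "'v graph" and r :: nat
  assumes simple: "simple_graph G" and r: "2 \<le> r"
begin

text \<open>The predicate depends only on the component of \<open>v\<close>, so the choice gives one
  base vertex per component.\<close>

definition root :: "'v \<Rightarrow> 'v" where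
  "root v = (SOME u. walks_between G v u \<noteq> {})"

definition rooted :: "'v list \<Rightarrow> bool" where
  "rooted w \<longleftrightarrow> walk G w \<and> root (hd w) = hd w"

definition cls :: "'v list \<Rightarrow> 'v list set" where
  "cls w = {w'. homotopic r G w w'}"

text \<open>The usual construction of a covering from walks at a base vertex modulo homotopy, done
  in all components at once because \<open>G\<close> may be disconnected.\<close>

definition cover :: "'v list set graph" where
  "cover = Graph (cls ` Collect rooted) {{cls w, cls (w @ [v])} | w v. w \<noteq> [] \<and> rooted (w @ [v])}"

text \<open>Homotopies keep endpoints, so on classes the choice of the member is immaterial.\<close>

definition proj :: "'v list set \<Rightarrow> 'v" where
  "proj C = last (SOME w. w \<in> C)"

lemma root_eq:
  assumes "walks_between G u v \<noteq> {}" shows "root u = root v"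
proof -
  have "walks_between G u z \<noteq> {} \<longleftrightarrow> walks_between G v z \<noteq> {}" for z
    using assms walks_between_join walks_between_rev by (metis all_not_in_conv)
  then show ?thesis by (simp add: root_def)
qed

lemma walks_between_root:
  assumes "v \<in> verts G" shows "walks_between G v (root v) \<noteq> {}"
proof -
  have "[v] \<in> walks_between G v v" using assms by (simp add: walks_between_def walk_def)
  then show ?thesis unfolding root_def by (metis (mono_tags, lifting) empty_iff someI)
qed

lemma root_root: "v \<in> verts G \<Longrightarrow> root (root v) = root v"
  using root_eq walks_between_root by metis

lemma rooted_ne: "rooted w \<Longrightarrow> w \<noteq> []"
  by (auto simp: rooted_def walk_def)

lemma rooted_append: "rooted w \<Longrightarrow> walk G (w @ ys) \<Longrightarrow> rooted (w @ ys)"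
  using rooted_ne by (auto simp: rooted_def)

lemma rooted_snoc: "w \<noteq> [] \<Longrightarrow> rooted (w @ [v]) \<longleftrightarrow> rooted w \<and> {last w, v} \<in> edges G"
  using walk_snoc[OF simple] by (auto simp: rooted_def)

lemma cls_eq_iff: "cls w = cls w' \<longleftrightarrow> homotopic r G w w'"
proof
  assume "cls w = cls w'"
  moreover have "w' \<in> cls w'" by (simp add: cls_def)
  ultimately have "w' \<in> cls w" by simp
  then show "homotopic r G w w'" by (simp add: cls_def)
next
  assume "homotopic r G w w'"
  then show "cls w = cls w'" unfolding cls_def using equivclp_sym equivclp_trans by fast
qed

lemma proj_cls [simp]: "proj (cls w) = last w"
proof -
  have "w \<in> cls w" by (simp add: cls_def)
  then have "(SOME w'. w' \<in> cls w) \<in> cls w" by (rule someI)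
  then have "homotopic r G w (SOME w'. w' \<in> cls w)" by (simp add: cls_def)
  then show ?thesis using homotopic_invariants unfolding proj_def by metis
qed

lemma cover_vertsE:
  assumes "Q \<in> verts cover" obtains w where "rooted w" "Q = cls w"
  using assms by (auto simp: cover_def)

lemma cls_in_cover: "rooted w \<Longrightarrow> cls w \<in> verts cover"
  by (simp add: cover_def)

text \<open>Edges at a class can be read off from any representative: an edge recorded from its
  other end is turned round by cancelling a backtrack.\<close>

lemma cover_edge_iff:
  assumes w: "rooted w"
  shows "{cls w, Q} \<in> edges cover \<longleftrightarrow> (\<exists>v. {last w, v} \<in> edges G \<and> Q = cls (w @ [v]))"
proof
  assume "{cls w, Q} \<in> edges cover"
  then obtain u v where uv: "u \<noteq> []" "rooted (u @ [v])" "{cls w, Q} = {cls u, cls (u @ [v])}"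
    by (auto simp: cover_def)
  have e: "{last u, v} \<in> edges G" using uv rooted_snoc by blast
  from uv(3) consider "cls w = cls u" "Q = cls (u @ [v])" | "cls w = cls (u @ [v])" "Q = cls u"
    by (auto simp: doubleton_eq_iff)
  then show "\<exists>v. {last w, v} \<in> edges G \<and> Q = cls (w @ [v])"
  proof cases
    case 1
    then have "homotopic r G w u" by (simp add: cls_eq_iff)
    then have "last w = last u" "cls (w @ [v]) = cls (u @ [v])"
      using homotopic_invariants homotopic_append by (blast, simp add: cls_eq_iff)
    then show ?thesis using e 1 by metis
  next
    case 2
    then have h: "homotopic r G w (u @ [v])" by (simp add: cls_eq_iff)
    then have l: "last w = v" using homotopic_invariants[OF h] by simp
    have "homotopic r G (w @ [last u]) (u @ [v, last u])" using homotopic_append[OF h, of "[last u]"] by simp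
    then have "cls (w @ [last u]) = cls u"
      using homotopic_backtrack[OF simple r uv(1) e] equivclp_trans cls_eq_iff by metis
    then show ?thesis using e l 2 by (metis insert_commute)
  qed
next
  assume "\<exists>v. {last w, v} \<in> edges G \<and> Q = cls (w @ [v])"
  then obtain v where "{last w, v} \<in> edges G" "Q = cls (w @ [v])" by blast
  then show "{cls w, Q} \<in> edges cover" using rooted_ne[OF w] rooted_snoc w unfolding cover_def by auto
qed

lemma simple_cover: "simple_graph cover"
  unfolding simple_graph_def
proof
  fix e assume "e \<in> edges cover"
  then obtain w v where w: "w \<noteq> []" "rooted (w @ [v])" "e = {cls w, cls (w @ [v])}" by (auto simp: cover_def)
  then have wv: "rooted w" "{last w, v} \<in> edges G" using rooted_snoc by blast+
  then have "last w \<noteq> v" using simple unfolding simple_graph_def by fastforce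
  then have "cls w \<noteq> cls (w @ [v])" by (metis proj_cls last_snoc)
  then show "\<exists>u\<in>verts cover. \<exists>v\<in>verts cover. u \<noteq> v \<and> e = {u, v}"
    using w wv cls_in_cover by blast
qed

lemma cover_hom: "graph_hom cover G proj"
  unfolding graph_hom_def
proof (intro conjI ballI)
  show "proj ` verts cover \<subseteq> verts G"
    using last_in_set by (fastforce simp: cover_def rooted_def walk_def)
  fix e assume "e \<in> edges cover"
  then obtain w v where "w \<noteq> []" "rooted (w @ [v])" "e = {cls w, cls (w @ [v])}" by (auto simp: cover_def)
  then show "proj ` e \<in> edges G" using rooted_snoc by auto
qed

lemma cover_walk_lift:
  assumes "rooted w"
  shows "walk G (w @ ys) \<Longrightarrow> \<exists>P\<in>walks_between cover (cls w) (cls (w @ ys)). length P = Suc (length ys)"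
proof (induction ys rule: rev_induct)
  case Nil
  have "[cls w] \<in> walks_between cover (cls w) (cls w)"
    using cls_in_cover[OF assms] by (simp add: walks_between_def walk_def)
  then show ?case by force
next
  case (snoc v ys)
  have ne: "w @ ys \<noteq> []" using rooted_ne[OF assms] by simp
  have ys: "walk G (w @ ys)" "{last (w @ ys), v} \<in> edges G" using snoc.prems walk_snoc[OF simple ne] by auto
  then obtain P where P: "P \<in> walks_between cover (cls w) (cls (w @ ys))" "length P = Suc (length ys)"
    using snoc.IH by blast
  have "{cls (w @ ys), cls (w @ ys @ [v])} \<in> edges cover"
    using cover_edge_iff[OF rooted_append[OF assms ys(1)]] ys(2) by force
  then have "P @ [cls (w @ ys @ [v])] \<in> walks_between cover (cls w) (cls (w @ ys @ [v]))"
    using P(1) walk_snoc[OF simple_cover, of P] by (auto simp: walks_between_def walk_def)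
  then show ?case using P by force
qed

text \<open>Each step of a walk in the cover extends the representative by one projected vertex;
  \<open>tl\<close> drops the start, which \<open>w\<close> already reaches. For a closed walk this
  yields a homotopy between \<open>w\<close> and its continuation.\<close>

lemma cover_walk_end:
  "rooted w \<Longrightarrow> P \<in> walks_between cover (cls w) Q \<Longrightarrow>
    walk G (w @ tl (map proj P)) \<and> Q = cls (w @ tl (map proj P))"
proof (induction P arbitrary: w)
  case Nil
  then show ?case by (simp add: walks_between_def walk_def)
next
  case (Cons A P)
  have A: "A = cls w" using Cons.prems by (simp add: walks_between_def)
  show ?case
  proof (cases P)
    case Nil
    then show ?thesis using Cons.prems A by (auto simp: walks_between_def rooted_def)
  next
    case (Cons B P')
    then have "{cls w, B} \<in> edges cover" and P: "P \<in> walks_between cover B Q"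
      using Cons.prems A by (auto simp: walks_between_def walk_def)
    then obtain v where v: "{last w, v} \<in> edges G" "B = cls (w @ [v])"
      using cover_edge_iff Cons.prems(1) by blast
    then have "rooted (w @ [v])" using rooted_snoc rooted_ne Cons.prems(1) by blast
    from Cons.IH[OF this] show ?thesis using P v Cons by simp
  qed
qed

section \<open>Distances, incidence and connectedness in the cover\<close>

lemma cover_gdistE:
  assumes w: "rooted w" and "gdist cover (cls w) Q \<le> enat k"
  obtains ys where "walk G (w @ ys)" "Q = cls (w @ ys)" "length ys \<le> k"
proof -
  obtain P where "P \<in> walks_between cover (cls w) Q" "length P \<le> Suc k"
    using assms(2) unfolding gdist_le_iff by blast
  then show thesis using cover_walk_end[OF w, of P Q] that[of "tl (map proj P)"] by auto
qed

lemma cover_gdist_lift: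
  assumes w: "rooted w" and "gdist G (last w) u \<le> enat k"
  obtains Q where "Q \<in> verts cover" "gdist cover (cls w) Q \<le> enat k" "proj Q = u"
proof -
  obtain xs where xs: "walk G xs" "hd xs = last w" "last xs = u" "length xs \<le> Suc k"
    using assms(2) unfolding gdist_le_iff walks_between_def by blast
  have "w @ tl xs \<in> walks_between G (hd w) u"
    using w xs by (intro walks_between_join[of w G _ "last w"]) (auto simp: walks_between_def rooted_def)
  then have t: "walk G (w @ tl xs)" "last (w @ tl xs) = u" by (auto simp: walks_between_def)
  obtain P where P: "P \<in> walks_between cover (cls w) (cls (w @ tl xs))" "length P = Suc (length (tl xs))"
    using cover_walk_lift[OF w t(1)] by blast
  have "length P \<le> Suc k" using P(2) xs by simp
  then have "gdist cover (cls w) (cls (w @ tl xs)) \<le> enat k" unfolding gdist_le_iff using P(1) by blast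
  then show thesis using that cls_in_cover[OF rooted_append[OF w t(1)]] t(2) by simp
qed

text \<open>Vertices close to \<open>cls w\<close> are classes of short continuations of
  \<open>w\<close>, and \<open>homotopic_short\<close> identifies two of these with a common
  end.\<close>

lemma cover_ball_inj:
  assumes w: "rooted w" and d: "gdist cover (cls w) A \<le> enat k" "gdist cover (cls w) B \<le> enat l"
    and kl: "k + l \<le> r" and eq: "proj A = proj B"
  shows "A = B"
proof -
  obtain ys zs where "walk G (w @ ys)" "A = cls (w @ ys)" "length ys \<le> k"
    "walk G (w @ zs)" "B = cls (w @ zs)" "length zs \<le> l"
    using cover_gdistE[OF w d(1)] cover_gdistE[OF w d(2)] by metis
  then show ?thesis
    using homotopic_short[OF simple r rooted_ne[OF w], of ys zs] kl eq by (simp add: cls_eq_iff)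
qed

text \<open>The strict bound leaves room for one more step, so \<open>homotopic_short\<close>
  applies to \<open>ys\<close> extended by \<open>proj B\<close>. It matches the strict inequality
  for edges in \<open>half_ball\<close>.\<close>

lemma cover_ball_edge:
  assumes w: "rooted w" and d: "gdist cover (cls w) A \<le> enat k" "gdist cover (cls w) B \<le> enat l"
    and kl: "k + l < r" and e: "{proj A, proj B} \<in> edges G"
  shows "{A, B} \<in> edges cover"
proof -
  obtain ys zs where y: "walk G (w @ ys)" "A = cls (w @ ys)" "length ys \<le> k"
    and z: "walk G (w @ zs)" "B = cls (w @ zs)" "length zs \<le> l"
    using cover_gdistE[OF w d(1)] cover_gdistE[OF w d(2)] by metis
  have e': "{last (w @ ys), proj B} \<in> edges G" using e y(2) by simp
  then have "walk G (w @ ys @ [proj B])" using walk_snoc[OF simple, of "w @ ys"] y(1) rooted_ne[OF w] by simp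
  then have "homotopic r G (w @ ys @ [proj B]) (w @ zs)"
    using homotopic_short[OF simple r rooted_ne[OF w], of "ys @ [proj B]" zs] y z kl by simp
  then have "B = cls ((w @ ys) @ [proj B])" using z(2) by (simp add: cls_eq_iff equivclp_sym)
  then show ?thesis using cover_edge_iff[OF rooted_append[OF w y(1)]] e' y(2) by blast
qed

text \<open>Both sets of edges are parametrised by the neighbours of \<open>last w\<close> in
  \<open>G\<close>, and \<open>proj\<close> respects the parameters.\<close>

lemma cover_incident_bij:
  assumes Q: "Q \<in> verts cover"
  shows "bij_betw (image proj) (incident cover Q) (incident G (proj Q))"
proof -
  obtain w where w: "rooted w" "Q = cls w" using Q by (rule cover_vertsE)
  have pair: "\<exists>y. e = {x, y}" if H: "simple_graph H" "e \<in> incident H x" for e x and H :: "'z graph"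
  proof -
    have "e \<in> edges H" "x \<in> e" using H by (simp_all add: incident_def)
    moreover from this obtain u v where "e = {u, v}" using H(1) unfolding simple_graph_def by metis
    ultimately show ?thesis by (metis insertE insert_commute singletonD)
  qed
  have inc: "incident cover Q = (\<lambda>v. {cls w, cls (w @ [v])}) ` {v. {last w, v} \<in> edges G}"
  proof (intro equalityI subsetI)
    fix e assume e: "e \<in> incident cover Q"
    then obtain B where "e = {cls w, B}" using pair[OF simple_cover e] w by blast
    then show "e \<in> (\<lambda>v. {cls w, cls (w @ [v])}) ` {v. {last w, v} \<in> edges G}"
      using e cover_edge_iff[OF w(1)] by (auto simp: incident_def)
  next
    fix e assume "e \<in> (\<lambda>v. {cls w, cls (w @ [v])}) ` {v. {last w, v} \<in> edges G}"
    then show "e \<in> incident cover Q" using cover_edge_iff[OF w(1)] w(2) by (auto simp: incident_def)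
  qed
  have "inj_on (image proj) (incident cover Q)"
    unfolding inc by (rule inj_onI) (auto simp: doubleton_eq_iff)
  moreover have "image proj ` incident cover Q = (\<lambda>v. {last w, v}) ` {v. {last w, v} \<in> edges G}"
    unfolding inc by (force simp: image_image)
  moreover have "\<dots> = incident G (proj Q)"
    using pair[OF simple] w(2) by (fastforce simp: incident_def)
  ultimately show ?thesis by (simp add: bij_betw_def)
qed

lemma walk_in_preimage:
  "walk cover P \<Longrightarrow> proj (hd P) \<in> verts (component G x) \<Longrightarrow> walk (preimage_graph cover proj (component G x)) P"
proof (induction P)
  case Nil
  then show ?case by (simp add: walk_def)
next
  case (Cons A P)
  have A: "A \<in> verts (preimage_graph cover proj (component G x))"
    using Cons.prems by (auto simp: walk_def preimage_graph_def)
  show ?case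
  proof (cases P)
    case Nil
    then show ?thesis using A by (simp add: walk_def)
  next
    case (Cons B P')
    then have P: "walk cover P" and e: "{A, B} \<in> edges cover" using Cons.prems by (auto simp: walk_def)
    then have "proj ` {A, B} \<in> edges G" using cover_hom unfolding graph_hom_def by blast
    then have e': "{proj A, proj B} \<in> edges G" by simp
    have V: "proj A \<in> verts G" "proj B \<in> verts G" using simple_graph_edge_subset[OF simple e'] by auto
    obtain xs where xs: "xs \<in> walks_between G x (proj A)"
      using Cons.prems by (auto simp: component_def induced_def)
    have "[proj A, proj B] \<in> walks_between G (proj A) (proj B)" using e' V by (simp add: walks_between_def walk_def)
    from walks_between_join[OF xs this] have B: "walks_between G x (proj B) \<noteq> {}" by blast
    then have "{A, B} \<in> edges (preimage_graph cover proj (component G x))"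
      using e e' xs by (auto simp: preimage_graph_def component_def induced_def)
    moreover have "walk (preimage_graph cover proj (component G x)) P"
      using Cons.IH P B V Cons by (simp add: component_def induced_def)
    ultimately show ?thesis using A Cons by (simp add: walk_def)
  qed
qed

text \<open>Every class over the component is joined to the class of the trivial walk at the base
  vertex by lifting a representative; \<open>walk_in_preimage\<close> keeps the lift over the
  component.\<close>

lemma cover_connected:
  assumes x: "x \<in> verts G"
  shows "connected_graph (preimage_graph cover proj (component G x))" (is "connected_graph ?P")
proof -
  obtain xs where xs: "xs \<in> walks_between G x (root x)" using walks_between_root[OF x] by blast
  then have rx: "root x \<in> verts G" "walks_between G x (root x) \<noteq> {}"
    using last_in_set[of xs] by (auto simp: walks_between_def walk_def)
  let ?R = "cls [root x]"
  have rr: "rooted [root x]" using root_root[OF x] rx by (simp add: rooted_def walk_def)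
  have R: "?R \<in> verts ?P"
    using cls_in_cover[OF rr] rx by (simp add: preimage_graph_def component_def induced_def)
  have to: "walks_between ?P ?R Q \<noteq> {}" if Q: "Q \<in> verts ?P" for Q
  proof -
    obtain w where w: "rooted w" "Q = cls w" using Q cover_vertsE by (auto simp: preimage_graph_def)
    have "walks_between G x (last w) \<noteq> {}" using Q w by (simp add: preimage_graph_def component_def induced_def)
    moreover have "walks_between G (hd w) (last w) \<noteq> {}" using w by (auto simp: rooted_def walks_between_def)
    ultimately have "root x = hd w" using root_eq w by (metis rooted_def)
    then have hw: "w = [root x] @ tl w" using rooted_ne[OF w(1)] by simp
    then obtain P where "P \<in> walks_between cover ?R Q"
      using cover_walk_lift[OF rr, of "tl w"] w by (metis rooted_def)
    then have "P \<in> walks_between ?P ?R Q"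
      using walk_in_preimage[of P x] R by (auto simp: walks_between_def preimage_graph_def)
    then show ?thesis by blast
  qed
  show ?thesis
    unfolding connected_graph_def
  proof (intro conjI ballI)
    show "verts ?P \<noteq> {}" using R by blast
    fix A B assume "A \<in> verts ?P" "B \<in> verts ?P"
    then obtain xs ys where "xs \<in> walks_between ?P ?R A" "ys \<in> walks_between ?P ?R B" using to by blast
    then show "walks_between ?P A B \<noteq> {}" using walks_between_join walks_between_rev by (metis empty_iff)
  qed
qed

lemma covering_cover: "covering cover G proj"
proof -
  have "verts G \<subseteq> proj ` verts cover"
  proof
    fix x assume x: "x \<in> verts G"
    obtain xs where xs: "xs \<in> walks_between G x (root x)" using walks_between_root[OF x] by blast
    have "rooted (rev xs)" "last (rev xs) = x"
      using walks_between_rev[OF xs] root_root[OF x] by (auto simp: rooted_def walks_between_def)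
    then show "x \<in> proj ` verts cover" using cls_in_cover by (metis imageI proj_cls)
  qed
  then show ?thesis
    unfolding covering_def
    using simple simple_cover cover_hom cover_incident_bij cover_connected
    by (auto simp: graph_hom_def)
qed

text \<open>Distances up to \<open>r/2\<close> agree above and below: a shorter walk below would
  lift to one ending over the same vertex, and \<open>cover_ball_inj\<close> identifies the two
  ends. Edges of the balls then correspond by \<open>cover_ball_edge\<close>.\<close>

lemma ball_preserving_cover: "ball_preserving_covering r cover G proj"
  unfolding ball_preserving_covering_def
proof (intro conjI ballI covering_cover)
  fix A assume A: "A \<in> verts cover"
  then obtain w where w: "rooted w" "A = cls w" by (rule cover_vertsE)
  let ?H = "half_ball cover A r" and ?G = "half_ball G (proj A) r"
  have le: "gdist G (proj A) (proj Q) \<le> gdist cover A Q" for Q by (rule gdist_hom_le[OF cover_hom])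
  have eq: "gdist G (proj A) (proj Q) = enat k" if k: "gdist cover A Q = enat k" "2 * k \<le> r" for Q k
  proof -
    obtain l where l: "gdist G (proj A) (proj Q) = enat l" "l \<le> k"
      using le[of Q] k by (cases "gdist G (proj A) (proj Q)") auto
    obtain Q' where Q': "gdist cover (cls w) Q' \<le> enat l" "proj Q' = proj Q"
      using cover_gdist_lift[OF w(1), of "proj Q" l] l w by auto
    have "Q' = Q" using cover_ball_inj[OF w(1) Q'(1), of Q k] k l w Q' by simp
    then show ?thesis using Q' k l w by simp
  qed
  have HV: "Q \<in> verts ?H \<longleftrightarrow> Q \<in> verts cover \<and> (\<exists>k. gdist cover A Q = enat k \<and> 2 * k \<le> r)" for Q
    by (simp add: half_ball_def double_le_enat_iff)
  have GV: "u \<in> verts ?G \<longleftrightarrow> u \<in> verts G \<and> (\<exists>k. gdist G (proj A) u = enat k \<and> 2 * k \<le> r)" for u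
    by (simp add: half_ball_def double_le_enat_iff)
  have inj: "inj_on proj (verts ?H)"
  proof (rule inj_onI)
    fix P Q assume "P \<in> verts ?H" "Q \<in> verts ?H" "proj P = proj Q"
    moreover from this obtain k l where "gdist cover A P = enat k" "gdist cover A Q = enat l"
      "2 * k \<le> r" "2 * l \<le> r" using HV by blast
    ultimately show "P = Q" using cover_ball_inj[OF w(1), of P k Q l] w by simp
  qed
  have im: "proj ` verts ?H = verts ?G"
  proof (intro equalityI subsetI)
    fix u assume "u \<in> proj ` verts ?H"
    then show "u \<in> verts ?G" using eq cover_hom HV GV by (fastforce simp: graph_hom_def)
  next
    fix u assume "u \<in> verts ?G"
    then obtain k where k: "gdist G (proj A) u = enat k" "2 * k \<le> r" using GV by blast
    then obtain Q where Q: "Q \<in> verts cover" "gdist cover A Q \<le> enat k" "proj Q = u"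
      using cover_gdist_lift[OF w(1), of u k] w by auto
    then have "Q \<in> verts ?H" using HV k(2) by (cases "gdist cover A Q") auto
    then show "u \<in> proj ` verts ?H" using Q by blast
  qed
  show "graph_iso ?H ?G proj"
    unfolding graph_iso_def
  proof (intro conjI ballI)
    show "bij_betw proj (verts ?H) (verts ?G)" using inj im by (simp add: bij_betw_def)
    fix P Q assume "P \<in> verts ?H" "Q \<in> verts ?H"
    then obtain k l where kl: "gdist cover A P = enat k" "gdist cover A Q = enat l" "2 * k \<le> r" "2 * l \<le> r"
      using HV by blast
    have "{P, Q} \<in> edges cover \<Longrightarrow> proj ` {P, Q} \<in> edges G"
      using cover_hom unfolding graph_hom_def by blast
    moreover have "{proj P, proj Q} \<in> edges G \<Longrightarrow> k + l < r \<Longrightarrow> {P, Q} \<in> edges cover"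
      using cover_ball_edge[OF w(1), of P k Q l] kl w by simp
    ultimately show "{P, Q} \<in> edges ?H \<longleftrightarrow> {proj P, proj Q} \<in> edges ?G"
      using kl eq[OF kl(1,3)] eq[OF kl(2,4)]
      by (auto simp: half_ball_edge_iff[OF simple] half_ball_edge_iff[OF simple_cover])
  qed
qed

end

section \<open>Lifting homotopies\<close>

lemma walk_successively_near:
  assumes "simple_graph G" "walk G xs" shows "successively (near G) xs"
proof (rule successively_mono)
  show "successively (\<lambda>x y. {x, y} \<in> edges G) xs" using assms(2) by (simp add: walk_def)
  show "near G x y" if "{x, y} \<in> edges G" for x y
    using that simple_graph_edge_subset[OF assms(1) that] by (simp add: near_def)
qed

text \<open>Without its repeated base vertex the loop has at most \<open>r\<close> entries, so
  \<open>closed_walk_fillable\<close> only meets cycles covered by \<open>r_chordal\<close>. A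
  degenerate triangle restores the repeated vertex.\<close>

lemma short_loop_fillable:
  assumes G: "simple_graph G" and ch: "r_chordal r G" and c: "short_loop r G c" and l: "2 \<le> length c"
  shows "fillable G c"
proof -
  have w: "walk G c" "hd c = last c" "length c \<le> Suc r" using c by (auto simp: short_loop_def)
  obtain b x where cb: "c = b @ [x]" using l by (cases c rule: rev_cases) auto
  have s: "successively (near G) (b @ [x])" using walk_successively_near[OF G w(1)] cb by simp
  have ne: "b \<noteq> []" "hd b = x" using l w(2) cb by (auto simp: hd_append split: if_splits)
  then have bx: "successively (near G) b" "near G (last b) x" using s by (auto simp: successively_append_iff)
  show ?thesis
  proof (cases "length b = 1")
    case True
    then obtain y where "b = [y]" by (auto simp: length_Suc_conv)
    then show ?thesis using bx cb by (simp add: fillable.edge)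
  next
    case False
    then have "2 \<le> length b" using ne by (cases b) (auto simp: Suc_le_eq)
    moreover have "near G (hd b) (last b)" using bx(2) near_sym ne by metis
    moreover have "length b \<le> r" using w(3) cb by simp
    moreover have "has_chord G xs" if "is_cycle G xs" "4 \<le> length xs" "length xs \<le> r" for xs
      using ch that by (simp add: r_chordal_def)
    ultimately have "fillable G b"
      using closed_walk_fillable[OF G, of r UNIV b] bx(1) by blast
    moreover have "fillable G [last b, x]" using bx(2) by (rule fillable.edge)
    ultimately have "fillable G (b @ tl [last b, x])"
      using near_refl(2)[OF bx(2)] ne by (intro fillable_join) auto
    then show ?thesis using cb by simp
  qed
qed

text \<open>Ball preservation makes short loops lift to short loops, so a homotopy in the base lifts;
  splicing in a short loop does not change fillability.\<close>

lemma insert_loop_lift: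
  assumes b: "ball_preserving_covering r H G p" and ch: "r_chordal r H" and wf: "wheel_free H" and u: "u \<noteq> []"
    and i: "insert_loop r G W W'"
  shows "(\<exists>V. walk H V \<and> map p V = W \<and> hd V = a \<and> fillable H (u @ V)) \<longleftrightarrow>
    (\<exists>V. walk H V \<and> map p V = W' \<and> hd V = a \<and> fillable H (u @ V))"
proof -
  have c: "covering H G p" using b by (simp add: ball_preserving_covering_def)
  then have H: "simple_graph H" by (simp add: covering_def)
  obtain us l vs where l: "short_loop r G l" and W: "W = us @ hd l # vs" "W' = us @ l @ vs"
    using i unfolding insert_loop_def by blast
  have lw: "walk G l" "hd l = last l" "length l \<le> Suc r" using l by (auto simp: short_loop_def)
  have lne: "l \<noteq> []" using lw by (simp add: walk_def)
  \<comment> \<open>Any lift \<open>L\<close> of the loop \<open>l\<close> is closed by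
    \<open>short_walk_closed\<close>, hence again a short loop that can be spliced in or
    out.\<close>
  have key: "hd (A @ L @ B) = hd (A @ hd L # B) \<and> (walk H (A @ L @ B) \<longleftrightarrow> walk H (A @ hd L # B)) \<and>
      (fillable H (u @ A @ L @ B) \<longleftrightarrow> fillable H (u @ A @ hd L # B))"
    if L: "walk H L" "map p L = l" for A L B
  proof -
    have Lne: "L \<noteq> []" using L lne by auto
    have "p (hd L) = p (last L)" using L lw(2) Lne by (metis hd_map last_map)
    moreover have len: "length L \<le> Suc r" using L(2) lw(3) by auto
    ultimately have hl: "hd L = last L" using short_walk_closed[OF b L(1)] by blast
    have "fillable H (u @ A @ L @ B) \<longleftrightarrow> fillable H (u @ A @ hd L # B)"
    proof (cases "2 \<le> length L")
      case True
      have "fillable H L" using short_loop_fillable[OF H ch _ True] L(1) hl len by (simp add: short_loop_def)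
      from fillable_splice[OF H wf this hl, of "u @ A" B] show ?thesis using u by simp
    next
      case False
      then have "L = [hd L]" using Lne by (cases L; cases "tl L") auto
      then show ?thesis by (metis append_Cons append_Nil)
    qed
    then show ?thesis using walk_insert_loop[OF L(1) hl] Lne by (simp add: hd_append)
  qed
  show ?thesis
  proof
    assume "\<exists>V. walk H V \<and> map p V = W \<and> hd V = a \<and> fillable H (u @ V)"
    then obtain V where V: "walk H V" "map p V = W" "hd V = a" "fillable H (u @ V)" by blast
    then obtain A x B where VA: "V = A @ x # B" "map p A = us" "p x = hd l" "map p B = vs"
      unfolding W by (auto simp: map_eq_append_conv map_eq_Cons_conv)
    have "x \<in> verts H" using V(1) VA(1) by (simp add: walk_def)
    then obtain L where L: "walk H L" "hd L = x" "map p L = l"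
      using covering_walk_lift[OF c lw(1) _ VA(3)] by blast
    then show "\<exists>V. walk H V \<and> map p V = W' \<and> hd V = a \<and> fillable H (u @ V)"
      using key[OF L(1,3), of A B] V VA W by (intro exI[of _ "A @ L @ B"]) simp
  next
    assume "\<exists>V. walk H V \<and> map p V = W' \<and> hd V = a \<and> fillable H (u @ V)"
    then obtain V where V: "walk H V" "map p V = W'" "hd V = a" "fillable H (u @ V)" by blast
    obtain A D where AD: "V = A @ D" "map p A = us" "map p D = l @ vs"
      using V(2) unfolding W by (metis map_eq_append_conv)
    then obtain L B where "D = L @ B" "map p L = l" "map p B = vs" by (metis map_eq_append_conv)
    then have VA: "V = A @ L @ B" "map p A = us" "map p L = l" "map p B = vs" using AD by auto
    have Lne: "L \<noteq> []" using VA lne by auto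
    have "walk H L"
      using V(1) Lne unfolding VA(1) walk_def by (auto simp: successively_append_iff)
    note k = key[OF this VA(3), of A B]
    have "p (hd L) = hd l" using VA(3) Lne by (metis hd_map)
    then show "\<exists>V. walk H V \<and> map p V = W \<and> hd V = a \<and> fillable H (u @ V)"
      using k V VA W by (intro exI[of _ "A @ hd L # B"]) simp
  qed
qed

text \<open>The prefix \<open>u\<close> stays fixed and closes the moving walk \<open>V\<close> into
  a polygon, so that fillability can be carried along each elementary move in either
  direction.\<close>

lemma homotopy_lift:
  assumes "ball_preserving_covering r H G p" "r_chordal r H" "wheel_free H" "u \<noteq> []"
    and h: "homotopic r G W W'"
    and W: "\<exists>V. walk H V \<and> map p V = W \<and> hd V = a \<and> fillable H (u @ V)"
  shows "\<exists>V. walk H V \<and> map p V = W' \<and> hd V = a \<and> fillable H (u @ V)"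
  using h
proof (induction rule: equivclp_induct)
  case base
  show ?case by (rule W)
next
  case (step y z)
  from step.hyps(2) show ?case
  proof
    assume "insert_loop r G y z"
    from insert_loop_lift[OF assms(1-4) this] step.IH show ?thesis by blast
  next
    assume "insert_loop r G z y"
    from insert_loop_lift[OF assms(1-4) this] step.IH show ?thesis by blast
  qed
qed

text \<open>Universality enters here: \<open>pr\<close> factors through the cover by homotopy
  classes, so appending the projected loop to \<open>w\<close> does not change its class. Lifting
  this homotopy turns the fillable polygon \<open>rev R @ R\<close> into
  \<open>rev R @ R @ ys\<close>, from which \<open>R\<close> is cancelled.\<close>

lemma local_cover_loop_fillable:
  assumes lc: "local_covering r Gr G pr" and r: "2 \<le> r" and ch: "r_chordal r Gr" and wf: "wheel_free Gr"
    and xs: "walk Gr xs" "hd xs = last xs" "2 \<le> length xs"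
  shows "fillable Gr xs"
proof -
  have b: "ball_preserving_covering r Gr G pr" using lc by (simp add: local_covering_def)
  then have c: "covering Gr G pr" by (simp add: ball_preserving_covering_def)
  then have G: "simple_graph G" and Gr: "simple_graph Gr" by (auto simp: covering_def)
  interpret walk_cover G r using G r by unfold_locales
  obtain q where q: "covering Gr cover q" and pq: "\<And>v. v \<in> verts Gr \<Longrightarrow> pr v = proj (q v)"
    using local_covering_universal[OF lc ball_preserving_cover] by blast
  define x where "x = hd xs"
  obtain ys where xys: "xs = x # ys" "ys \<noteq> []" using xs(3) by (cases xs) (auto simp: x_def Suc_le_eq)
  have V: "set xs \<subseteq> verts Gr" using xs(1) by (simp add: walk_def)
  then have x: "x \<in> verts Gr" using xys by simp
  have hom: "graph_hom Gr cover q" using q by (simp add: covering_def)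
  then have "q x \<in> verts cover" using x by (auto simp: graph_hom_def)
  then obtain w where w: "rooted w" "q x = cls w" by (rule cover_vertsE)
  have "xs \<in> walks_between Gr x x" using xs by (simp add: walks_between_def x_def)
  from walks_between_map[OF hom this] have "map q xs \<in> walks_between cover (cls w) (cls w)" using w by simp
  from cover_walk_end[OF w(1) this] have "cls w = cls (w @ tl (map proj (map q xs)))" by blast
  moreover have "map proj (map q xs) = map pr xs" using pq V by auto
  ultimately have "cls w = cls (w @ tl (map pr xs))" by metis
  then have h: "homotopic r G w (w @ map pr ys)" using xys by (simp add: cls_eq_iff)
  \<comment> \<open>Only the end of \<open>w\<close> has a prescribed lift, namely \<open>x\<close>;
    so \<open>w\<close> is lifted backwards and the lift is reversed.\<close>
  have "walk G (rev w)" "pr x = hd (rev w)"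
    using w pq[OF x] rooted_ne[OF w(1)] by (auto simp: rooted_def walk_rev hd_rev)
  from covering_walk_lift[OF c this(1) x this(2)]
  obtain W where W: "walk Gr W" "hd W = x" "map pr W = rev w" by blast
  have Wne: "W \<noteq> []" using W by (simp add: walk_def)
  define R where "R = rev W"
  have R: "walk Gr R" "last R = x" "map pr R = w" "R \<noteq> []" "rev R \<noteq> []"
    using W Wne by (auto simp: R_def walk_rev last_rev rev_map[symmetric])
  have "fillable Gr (rev R @ R)" using fillable_rev_append[OF R(1)] .
  then obtain V' where V': "walk Gr V'" "map pr V' = w @ map pr ys" "hd V' = hd R" "fillable Gr (rev R @ V')"
    using homotopy_lift[OF b ch wf R(5) h, of "hd R"] R by blast
  have "R @ tl xs \<in> walks_between Gr (hd R) (last xs)"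
    using R xs by (intro walks_between_join[of R Gr _ x]) (auto simp: walks_between_def x_def)
  then have Rys: "walk Gr (R @ ys)" using xys by (simp add: walks_between_def)
  \<comment> \<open>Both walks start at \<open>hd R\<close> and lift \<open>w @ map pr ys\<close>,
    so unique lifting recovers the given loop.\<close>
  have "V' = R @ ys"
    using covering_unique_walk_lifting[OF c V'(1) Rys] V' R by simp
  then have "fillable Gr (last R # ys)" using fillable_cancel_rev[OF Gr wf R(1) xys(2)] V'(4) by simp
  then show ?thesis using R xys by simp
qed

section \<open>Chordality of the local cover\<close>

theorem theorem2p10:
  fixes G :: "'a graph" and Gr :: "'b graph" and pr :: "'b \<Rightarrow> 'a" and r :: nat
  assumes "simple_graph G" and "r \<ge> 3" and "local_covering r Gr G pr"
  shows "chordal Gr \<longleftrightarrow> r_chordal r Gr \<and> wheel_free Gr"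
proof
  have Gr: "simple_graph Gr"
    using assms(3) by (simp add: local_covering_def ball_preserving_covering_def covering_def)
  {
    assume "chordal Gr"
    then show "r_chordal r Gr \<and> wheel_free Gr"
      using chordal_imp_wheel_free[OF Gr] by (auto simp: chordal_def r_chordal_def)
  next
    assume h: "r_chordal r Gr \<and> wheel_free Gr"
    show "chordal Gr"
      unfolding chordal_def
    proof (intro allI impI, rule ccontr)
      fix xs assume "is_cycle Gr xs \<and> 4 \<le> length xs" and nc: "\<not> has_chord Gr xs"
      then have c: "is_cycle Gr xs" and l: "4 \<le> length xs" by auto
      then have d: "distinct xs" "set xs \<subseteq> verts Gr" "cycle_edges xs \<subseteq> edges Gr" by (auto simp: is_cycle_def)
      have ne: "xs \<noteq> []" using l by auto
      have e: "{xs ! i, xs ! (Suc i mod length xs)} \<in> edges Gr" if "i < length xs" for i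
        using d(3) that unfolding cycle_edges_def by blast
      have "{xs ! i, xs ! Suc i} \<in> edges Gr" if "Suc i < length xs" for i using e[of i] that by simp
      then have w: "walk Gr xs" using d ne by (simp add: walk_def successively_conv_nth)
      have lh: "{last xs, hd xs} \<in> edges Gr"
        using e[of "length xs - 1"] ne by (simp add: last_conv_nth hd_conv_nth)
      \<comment> \<open>The cycle is closed up by repeating its first vertex to obtain a loop. The
        repeated vertex is deleted afterwards, since its polygon neighbours \<open>last xs\<close>
        and \<open>hd xs\<close> are adjacent.\<close>
      then have "walk Gr (xs @ [hd xs])" using walk_snoc[OF Gr ne] w by simp
      then have "fillable Gr (xs @ [hd xs])"
        using local_cover_loop_fillable[OF assms(3), of "xs @ [hd xs]"] assms(2) h ne l by simp
      moreover have "near Gr (hd xs) (last xs)"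
        using lh simple_graph_edge_subset[OF Gr lh] by (simp add: near_def insert_commute)
      moreover have "hd xs \<noteq> last xs" using lh Gr unfolding simple_graph_def by fastforce
      ultimately have "fillable Gr xs" using fillable_delete_last[OF Gr, of xs "hd xs"] h l by simp
      then show False using chordless_cycle_not_fillable[OF c nc l] by blast
    qed
  }
qed

end
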